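(* Let $k$ be a field, $A$ a (finite dimensional) Frobenius $k$-algebra, $\varphi\colon A\to k$ a Frobenius homomorphism and $\rho\colon A\to A$ the Nakayama automorphism of $A$ with respect to $\varphi$. Assume that $\rho$ has finite order $m=\operatorname{ord}_\rho$, that $k$ has a primitive $m$-th root of unity $w$, and that the $\mathbb Z/m\mathbb Z$-grading $A=A_0\oplus\cdots\oplus A_{m-1}$, $A_i=\{a\in A:\rho(a)=w^ia\}$, is strongly graded. Then, for all $n\ge 0$, $$\operatorname{HH}^n(A)\cong\operatorname{HH}^n(A_0)^{\mathbb Z/m\mathbb Z},$$ the space of invariants of $\operatorname{HH}^n(A_0)$ under the action of $\mathbb Z/m\mathbb Z$ described in the context.
   Context: Let $A$ be a finite dimensional $k$-algebra and let $DA=\operatorname{Hom}_k(A,k)$ with its usual $A$-bimodule structure: $(x f)(a)=f(ax)$ and $(f x)(a)=f(xa)$ for $f\in DA$, $x,a\in A$. $A$ is a Frobenius algebra if there is a linear form $\varphi\colon A\to k$ (a Frobenius homomorphism) such that $A\to DA$, $x\mapsto x\varphi$, is an isomorphism of left $A$-modules; equivalently $x\mapsto\varphi x$ is an isomorphism of right $A$-modules. The Nakayama automorphism of $A$ with respect to $\varphi$ is the algebra automorphism $\rho$ of $A$ determined by $x\varphi=\varphi\rho(x)$ for all $x\in A$. It has order $m\in\mathbb N$ (written $\operatorname{ord}_\rho=m$) if $\rho^m=\mathrm{id}_A$ and $\rho^r\neq\mathrm{id}_A$ for all $1\le r<m$. If $\rho$ has finite order $m$ and $w\in k$ is a primitive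 $m$-th root of unity, then $A=A_0\oplus\cdots\oplus A_{m-1}$ is a $\mathbb Z/m\mathbb Z$-graded algebra, where $A_i=\{a\in A:\rho(a)=w^ia\}$ (indices read modulo $m$). It is strongly $\mathbb Z/m\mathbb Z$-graded if $A_iA_j=A_{i+j}$ for all $i,j$, with $i+j$ the sum in $\mathbb Z/m\mathbb Z$. $\operatorname{HH}^*(A)$ and $\operatorname{HH}^*(A_0)$ denote the Hochschild cohomologies of $A$ and of $A_0$, with coefficients in $A$ and $A_0$ respectively. Action of $\mathbb Z/m\mathbb Z$ on $\operatorname{HH}^n(A_0)$ in the strongly graded case: for each $i\in\mathbb Z/m\mathbb Z$ choose finite families $(s_{i,j})_{j\in J_i}$ in $A_i$ and $(s'_{i,j})_{j\in J_i}$ in $A_{m-i}$ with $\sum_{j\in J_i}s'_{i,j}s_{i,j}=1$. The element $i$ acts on $\operatorname{HH}^n(A_0)$ by the map induced in cohomology by the endomorphism $\theta_i^*$ of the Hochschild cochain complex $(\operatorname{Hom}_k(A_0^{\otimes *},A_0),b^* )$ given by $$\theta_i^n(f)(a_1\otimes\cdots\otimes a_n)=\sum_{j_1,\dots,j_{n+1}\in J_i}s'_{i,j_1}\,f\big(s_{i,j_1}a_1s'_{i,j_2}\otimes s_{i,j_2}a_2s'_{i,j_3}\otimes\cdots\otimes s_{i,j_n}a_ns'_{i,j_{n+1}}\big)\,s_{i,j_{n+1}}.$$ *)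

theory Defs
  imports Complex_Main "HOL-Library.Function_Algebras" "HOL-Library.Set_Algebras"
begin

section \<open>Algebras over a field\<close>

text \<open>
  An associative unital \<open>k\<close>-algebra is carried by a whole type of sort \<open>{ring, monoid_mult}\<close>.
  This sort is used instead of \<open>ring_1\<close> because the latter excludes the zero algebra.
\<close>

locale algebra_over_field = vector_space scale
  for scale :: "'k::field \<Rightarrow> 'a::{ring, monoid_mult} \<Rightarrow> 'a" +
  assumes scale_mult_left: "scale c x * y = scale c (x * y)"
    and scale_mult_right: "x * scale c y = scale c (x * y)"

definition algebra_automorphism ::
    "('k::field \<Rightarrow> 'a::{ring, monoid_mult} \<Rightarrow> 'a) \<Rightarrow> ('a \<Rightarrow> 'a) \<Rightarrow> bool" where
  "algebra_automorphism scale \<rho> \<longleftrightarrow>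
     Vector_Spaces.linear scale scale \<rho> \<and> \<rho> 1 = 1 \<and> (\<forall>x y. \<rho> (x * y) = \<rho> x * \<rho> y) \<and> bij \<rho>"

definition has_order :: "('a \<Rightarrow> 'a) \<Rightarrow> nat \<Rightarrow> bool" where
  "has_order \<rho> m \<longleftrightarrow> 1 \<le> m \<and> \<rho> ^^ m = id \<and> (\<forall>r. 1 \<le> r \<and> r < m \<longrightarrow> \<rho> ^^ r \<noteq> id)"

definition primitive_root_of_unity :: "nat \<Rightarrow> 'k::field \<Rightarrow> bool" where
  "primitive_root_of_unity m w \<longleftrightarrow> 1 \<le> m \<and> w ^ m = 1 \<and> (\<forall>r. 1 \<le> r \<and> r < m \<longrightarrow> w ^ r \<noteq> 1)"


section \<open>Frobenius homomorphisms and Nakayama automorphisms\<close>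

definition dual :: "('k::field \<Rightarrow> 'a::{ring, monoid_mult} \<Rightarrow> 'a) \<Rightarrow> ('a \<Rightarrow> 'k) set" where
  "dual scale = {f. Vector_Spaces.linear scale (*) f}"

definition dual_lact :: "'a::{ring, monoid_mult} \<Rightarrow> ('a \<Rightarrow> 'k) \<Rightarrow> ('a \<Rightarrow> 'k)" where
  "dual_lact x f = (\<lambda>a. f (a * x))"

definition dual_ract :: "('a::{ring, monoid_mult} \<Rightarrow> 'k) \<Rightarrow> 'a \<Rightarrow> ('a \<Rightarrow> 'k)" where
  "dual_ract f x = (\<lambda>a. f (x * a))"

text \<open>
  For a linear form \<open>\<phi>\<close>, the map \<open>x \<mapsto> x \<phi>\<close> is always a morphism of left modules into the dual,
  so being an isomorphism means being bijective.
\<close>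

definition frobenius_hom ::
    "('k::field \<Rightarrow> 'a::{ring, monoid_mult} \<Rightarrow> 'a) \<Rightarrow> ('a \<Rightarrow> 'k) \<Rightarrow> bool" where
  "frobenius_hom scale \<phi> \<longleftrightarrow>
     \<phi> \<in> dual scale \<and> bij_betw (\<lambda>x. dual_lact x \<phi>) UNIV (dual scale)"

definition nakayama_automorphism ::
    "('k::field \<Rightarrow> 'a::{ring, monoid_mult} \<Rightarrow> 'a) \<Rightarrow> ('a \<Rightarrow> 'k) \<Rightarrow> ('a \<Rightarrow> 'a) \<Rightarrow> bool" where
  "nakayama_automorphism scale \<phi> \<rho> \<longleftrightarrow>
     algebra_automorphism scale \<rho> \<and> (\<forall>x. dual_lact x \<phi> = dual_ract \<phi> (\<rho> x))"


section \<open>The grading by eigenspaces\<close>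

definition eigencomponent ::
    "('k::field \<Rightarrow> 'a::{ring, monoid_mult} \<Rightarrow> 'a) \<Rightarrow> ('a \<Rightarrow> 'a) \<Rightarrow> 'k \<Rightarrow> nat \<Rightarrow> 'a set" where
  "eigencomponent scale \<rho> w i = {a. \<rho> a = scale (w ^ i) a}"

text \<open>
  Elements of \<open>\<int>/m\<int>\<close> are represented by the naturals below \<open>m\<close>. The product of two components
  is, as usual, the span of the products of their elements.
\<close>

definition strongly_graded ::
    "('k::field \<Rightarrow> 'a::{ring, monoid_mult} \<Rightarrow> 'a) \<Rightarrow> nat \<Rightarrow> (nat \<Rightarrow> 'a set) \<Rightarrow> bool" where
  "strongly_graded scale m A \<longleftrightarrow>
     (\<forall>i<m. \<forall>j<m. module.span scale {a * b | a b. a \<in> A i \<and> b \<in> A j} = A ((i + j) mod m))"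


section \<open>Hochschild cohomology\<close>

text \<open>
  The constants below are parametrized by a subset \<open>S\<close> of the type, meant to be (the carrier of)
  a subalgebra \<open>B\<close>; \<open>S = UNIV\<close> gives the whole algebra.  A linear map from the \<open>n\<close>-fold tensor
  power of \<open>B\<close> to \<open>B\<close> is represented by the corresponding \<open>n\<close>-linear map, which is a function on
  lists of length \<open>n\<close> over \<open>S\<close>; outside such lists it is normalized to be \<open>0\<close>.  Addition of
  cochains is the pointwise one of \<^theory>\<open>HOL-Library.Function_Algebras\<close>.
\<close>

definition tuples :: "'a set \<Rightarrow> nat \<Rightarrow> 'a list set" where
  "tuples S n = {xs. set xs \<subseteq> S \<and> length xs = n}"

definition hochschild_cochains ::
    "('k::field \<Rightarrow> 'a::{ring, monoid_mult} \<Rightarrow> 'a) \<Rightarrow> 'a set \<Rightarrow> nat \<Rightarrow> ('a list \<Rightarrow> 'a) set" where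
  "hochschild_cochains scale S n =
     {f. (\<forall>xs\<in>tuples S n. f xs \<in> S) \<and> (\<forall>xs. xs \<notin> tuples S n \<longrightarrow> f xs = 0) \<and>
         (\<forall>xs\<in>tuples S n. \<forall>i<n. \<forall>x\<in>S. \<forall>y\<in>S.
            f (xs[i := x + y]) = f (xs[i := x]) + f (xs[i := y])) \<and>
         (\<forall>xs\<in>tuples S n. \<forall>i<n. \<forall>c. \<forall>x\<in>S.
            f (xs[i := scale c x]) = scale c (f (xs[i := x])))}"

text \<open>
  With indices starting at \<open>0\<close>, the summand \<open>i < n\<close> multiplies the adjacent entries
  \<open>i\<close> and \<open>i + 1\<close>.
\<close>

definition hochschild_b ::
    "('k::field \<Rightarrow> 'a::{ring, monoid_mult} \<Rightarrow> 'a) \<Rightarrow> 'a set \<Rightarrow> nat \<Rightarrow> ('a list \<Rightarrow> 'a) \<Rightarrow> ('a list \<Rightarrow> 'a)"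
  where
  "hochschild_b scale S n f = (\<lambda>xs. if xs \<in> tuples S (Suc n) then
       hd xs * f (tl xs)
       + (\<Sum>i<n. scale ((- 1) ^ Suc i) (f (take i xs @ (xs ! i * xs ! Suc i) # drop (i + 2) xs)))
       + scale ((- 1) ^ Suc n) (f (butlast xs) * last xs)
     else 0)"

definition hochschild_cocycles ::
    "('k::field \<Rightarrow> 'a::{ring, monoid_mult} \<Rightarrow> 'a) \<Rightarrow> 'a set \<Rightarrow> nat \<Rightarrow> ('a list \<Rightarrow> 'a) set" where
  "hochschild_cocycles scale S n =
     {f \<in> hochschild_cochains scale S n. hochschild_b scale S n f = 0}"

fun hochschild_coboundaries ::
    "('k::field \<Rightarrow> 'a::{ring, monoid_mult} \<Rightarrow> 'a) \<Rightarrow> 'a set \<Rightarrow> nat \<Rightarrow> ('a list \<Rightarrow> 'a) set" where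
  "hochschild_coboundaries scale S 0 = {0}"
| "hochschild_coboundaries scale S (Suc n) =
     hochschild_b scale S n ` hochschild_cochains scale S n"

text \<open>
  The cohomology space is the set of cosets of the coboundaries in the cocycles.  The sum of two
  classes is their elementwise sum from \<^theory>\<open>HOL-Library.Set_Algebras\<close>; for a scalar
  multiple (and for an induced map) the coboundaries are added to the elementwise image, which
  itself need not be a full coset (for example for the scalar \<open>0\<close>).
\<close>

definition HH ::
    "('k::field \<Rightarrow> 'a::{ring, monoid_mult} \<Rightarrow> 'a) \<Rightarrow> 'a set \<Rightarrow> nat \<Rightarrow> ('a list \<Rightarrow> 'a) set set" where
  "HH scale S n = (\<lambda>f. f +o hochschild_coboundaries scale S n) ` hochschild_cocycles scale S n"

definition HH_scale ::
    "('k::field \<Rightarrow> 'a::{ring, monoid_mult} \<Rightarrow> 'a) \<Rightarrow> 'a set \<Rightarrow> nat \<Rightarrow>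
     'k \<Rightarrow> ('a list \<Rightarrow> 'a) set \<Rightarrow> ('a list \<Rightarrow> 'a) set" where
  "HH_scale scale S n c X = (\<lambda>f xs. scale c (f xs)) ` X + hochschild_coboundaries scale S n"

definition HH_induced ::
    "('k::field \<Rightarrow> 'a::{ring, monoid_mult} \<Rightarrow> 'a) \<Rightarrow> 'a set \<Rightarrow> nat \<Rightarrow>
     (('a list \<Rightarrow> 'a) \<Rightarrow> ('a list \<Rightarrow> 'a)) \<Rightarrow> ('a list \<Rightarrow> 'a) set \<Rightarrow> ('a list \<Rightarrow> 'a) set" where
  "HH_induced scale S n \<theta> X = \<theta> ` X + hochschild_coboundaries scale S n"


section \<open>The action of the cyclic group\<close>

text \<open>
  \<open>J\<close>, \<open>s\<close>, \<open>s'\<close> are the index sets and the two families chosen for each element of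
  \<open>\<int>/m\<int>\<close>.  Since \<open>w ^ m = 1\<close>, the component with index \<open>m - 0 = m\<close> is the one with index \<open>0\<close>.
\<close>

definition action_families ::
    "nat \<Rightarrow> (nat \<Rightarrow> 'a::{ring, monoid_mult} set) \<Rightarrow>
     (nat \<Rightarrow> 'j set) \<Rightarrow> (nat \<Rightarrow> 'j \<Rightarrow> 'a) \<Rightarrow> (nat \<Rightarrow> 'j \<Rightarrow> 'a) \<Rightarrow> bool" where
  "action_families m A J s s' \<longleftrightarrow>
     (\<forall>i<m. finite (J i) \<and> (\<forall>j\<in>J i. s i j \<in> A i \<and> s' i j \<in> A (m - i)) \<and>
            (\<Sum>j\<in>J i. s' i j * s i j) = 1)"

text \<open>The list \<open>js\<close> collects the \<open>n + 1\<close> independent summation indices.\<close>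

definition hochschild_theta ::
    "'a::{ring, monoid_mult} set \<Rightarrow> 'j set \<Rightarrow> ('j \<Rightarrow> 'a) \<Rightarrow> ('j \<Rightarrow> 'a) \<Rightarrow>
     nat \<Rightarrow> ('a list \<Rightarrow> 'a) \<Rightarrow> ('a list \<Rightarrow> 'a)" where
  "hochschild_theta S J s s' n f = (\<lambda>xs. if xs \<in> tuples S n then
       (\<Sum>js\<in>tuples J (Suc n).
          s' (js ! 0)
          * f (map (\<lambda>l. s (js ! l) * xs ! l * s' (js ! Suc l)) [0..<n])
          * s (js ! n))
     else 0)"

definition HH_invariants ::
    "('k::field \<Rightarrow> 'a::{ring, monoid_mult} \<Rightarrow> 'a) \<Rightarrow> 'a set \<Rightarrow> nat \<Rightarrow>
     (nat \<Rightarrow> 'j set) \<Rightarrow> (nat \<Rightarrow> 'j \<Rightarrow> 'a) \<Rightarrow> (nat \<Rightarrow> 'j \<Rightarrow> 'a) \<Rightarrow> nat \<Rightarrow> ('a list \<Rightarrow> 'a) set set" where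
  "HH_invariants scale S m J s s' n =
     {X \<in> HH scale S n.
        \<forall>i<m. HH_induced scale S n (hochschild_theta S (J i) (s i) (s' i) n) X = X}"

end

theory Submission
  imports Defs "HOL-Computational_Algebra.Polynomial"
begin

text \<open>
  Write \<open>A\<^sub>0\<close> for the fixed subalgebra of \<open>\<rho>\<close> and
  \<open>\<pi> = (1/m) \<Sum>\<^sub>r \<rho>\<^sup>r\<close> for the projection of \<open>A\<close> onto it; dividing by \<open>m\<close> is possible because
  a field with a primitive \<open>m\<close>-th root of unity has \<open>m \<noteq> 0\<close>. As \<open>\<pi>\<close> is a morphism of
  \<open>A\<^sub>0\<close>-bimodules, restricting a cochain of \<open>A\<close> to \<open>A\<^sub>0\<close> and composing with \<open>\<pi>\<close> is a cochain map
  \<open>Res\<close>. It induces the isomorphism.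

  Back from \<open>A\<^sub>0\<close> to \<open>A\<close> there is a transfer. Let \<open>\<kappa>\<close> and \<open>\<mu>\<close> range over the disjoint union \<open>K\<close> of
  the index sets \<open>J i\<close>, and let \<open>E\<^bsub>\<kappa>\<mu>\<^esub>(x) = \<pi>(s\<^bsub>\<kappa>\<^esub> x s'\<^bsub>\<mu>\<^esub>)\<close>. The choice of the families and orthogonality of
  characters of the cyclic group give
  \<open>\<Sum>\<^bsub>\<mu>\<^esub> \<pi>(x s'\<^bsub>\<mu>\<^esub>) s\<^bsub>\<mu>\<^esub> = x = \<Sum>\<^bsub>\<mu>\<^esub> s'\<^bsub>\<mu>\<^esub> \<pi>(s\<^bsub>\<mu>\<^esub> x)\<close>, so \<open>E\<close> is multiplicative as a map into matrices over
  \<open>A\<^sub>0\<close>, and the sum \<open>Tr f\<close> of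
  \<open>s'\<^bsub>\<kappa>(0)\<^esub> f(E\<^bsub>\<kappa>(0)\<kappa>(1)\<^esub>(a\<^sub>1), \<dots>, E\<^bsub>\<kappa>(n-1)\<kappa>(n)\<^esub>(a\<^sub>n)) s\<^bsub>\<kappa>(n)\<^esub>\<close> over all index sequences \<open>\<kappa>\<close> is a cochain
  map in \<open>f\<close> (\<open>transfer_chain_map\<close>). The maps \<open>\<theta>\<^sub>i\<close> have the same shape, with
  \<open>x \<mapsto> s x s'\<close> in the place of \<open>E\<close>. Whenever such a sum is formed over \<open>A\<close> itself, it is homotopic to
  the multiplication by \<open>\<Sum>\<^bsub>\<kappa>\<^esub> s'\<^bsub>\<kappa>\<^esub> s\<^bsub>\<kappa>\<^esub>\<close> if this is a scalar (\<open>transfer_homotopic_multiple\<close>): one slides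
  the factor \<open>s\<close> through the arguments. This has two uses. For \<open>\<theta>\<^sub>i\<close> the scalar is \<open>1\<close>, and hence every class in
  the image of \<open>Res\<close> is invariant. For \<open>E\<close> the scalar is \<open>m\<close>.

  \<^item> Surjectivity onto the invariants. Elements \<open>s x s'\<close> with \<open>x \<in> A\<^sub>0\<close> are homogeneous, and \<open>\<pi>\<close> kills
    them unless both indices lie in the same component, so \<open>Res (Tr f) = \<Sum>\<^sub>i \<theta>\<^sub>i f\<close>
    (\<open>restrict_extend\<close>). For an invariant class this is cohomologous to \<open>m f\<close>.

  \<^item> Injectivity. By the Frobenius property, \<open>\<rho>\<close> acts trivially on the cohomology of \<open>A\<close>
    (\<open>pullback_homotopic_id\<close>). The form \<open>\<phi>\<close> identifies cochains \<open>f\<close> with multilinear forms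
    \<open>\<phi>(a\<^sub>0 f(a\<^sub>1, \<dots>, a\<^sub>n))\<close>, on which the rotation twisted by \<open>\<rho>\<close> is defined; its \<open>(n+1)\<close>-st power is
    \<open>\<rho>\<close> applied to all the entries, and the cyclic homotopy (insert a unit after taking the norm)
    connects that power to the identity. So a cocycle \<open>f\<close> may be replaced by its average
    \<open>f'\<close> over the powers of \<open>\<rho>\<close>, whose values on arguments from \<open>A\<^sub>0\<close> are those of \<open>Res f\<close>. Then \<open>Tr (Res f)\<close>, formed
    from values on \<open>A\<^sub>0\<close> alone, equals the sum formed with \<open>f'\<close>, which is homotopic to \<open>m f'\<close>. If
    \<open>Res f\<close> is a coboundary, then so is \<open>f\<close>.
\<close>

section \<open>Multilinear maps and the Hochschild coboundary\<close>

text \<open>The target carries its own scalar multiplication, because both cochains (with values in the algebra)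
  and multilinear forms (with values in the field) occur.\<close>

definition multilinear_on ::
    "('k \<Rightarrow> 'a \<Rightarrow> 'a) \<Rightarrow> ('k \<Rightarrow> 'b \<Rightarrow> 'b) \<Rightarrow> 'a::ab_group_add set \<Rightarrow> nat \<Rightarrow> ('a list \<Rightarrow> 'b::ab_group_add) \<Rightarrow> bool"
  where
  "multilinear_on scl sclb S n f \<longleftrightarrow>
     (\<forall>xs\<in>tuples S n. \<forall>i<n. \<forall>x\<in>S. \<forall>y\<in>S. f (xs[i := x + y]) = f (xs[i := x]) + f (xs[i := y])) \<and>
     (\<forall>xs\<in>tuples S n. \<forall>i<n. \<forall>c. \<forall>x\<in>S. f (xs[i := scl c x]) = sclb c (f (xs[i := x])))"

lemma tuples_Suc: "xs \<in> tuples S (Suc n) \<longleftrightarrow> (\<exists>x ys. xs = x # ys \<and> x \<in> S \<and> ys \<in> tuples S n)"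
  by (cases xs) (auto simp: tuples_def)

lemma tuples_0 [simp]: "tuples S 0 = {[]}"
  by (auto simp: tuples_def)

lemma Cons_in_tuples [simp]: "x # ys \<in> tuples S (Suc n) \<longleftrightarrow> x \<in> S \<and> ys \<in> tuples S n"
  by (auto simp: tuples_Suc)

lemma multilinear_on_0 [simp]: "multilinear_on scl sclb S 0 f"
  by (simp add: multilinear_on_def)

text \<open>Sums over paths and the homotopies between them are defined by recursion over the list of
  arguments, each step plugging a value into the first argument. This equivalence makes
  multilinearity follow that recursion.\<close>

lemma multilinear_on_Suc:
  "multilinear_on scl sclb S (Suc n) f \<longleftrightarrow>
     (\<forall>x\<in>S. multilinear_on scl sclb S n (\<lambda>us. f (x # us))) \<and>
     (\<forall>us\<in>tuples S n. \<forall>x\<in>S. \<forall>y\<in>S. f ((x + y) # us) = f (x # us) + f (y # us)) \<and>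
     (\<forall>us\<in>tuples S n. \<forall>c. \<forall>x\<in>S. f (scl c x # us) = sclb c (f (x # us)))"
  (is "?L \<longleftrightarrow> ?R")
proof
  assume L: ?L
  have add: "f (xs[i := x + y]) = f (xs[i := x]) + f (xs[i := y])"
    if "xs \<in> tuples S (Suc n)" "i < Suc n" "x \<in> S" "y \<in> S" for xs i x y
    using L that by (auto simp: multilinear_on_def)
  have scl: "f (xs[i := scl c x]) = sclb c (f (xs[i := x]))"
    if "xs \<in> tuples S (Suc n)" "i < Suc n" "x \<in> S" for xs i x c
    using L that by (auto simp: multilinear_on_def)
  show ?R
    unfolding multilinear_on_def
  proof (intro conjI ballI allI impI)
    fix z xs i x y assume "z \<in> S" "xs \<in> tuples S n" "i < n" "x \<in> S" "y \<in> S"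
    then show "f (z # xs[i := x + y]) = f (z # xs[i := x]) + f (z # xs[i := y])"
      using add[of "z # xs" "Suc i" x y] by simp
  next
    fix z xs i c x assume "z \<in> S" "xs \<in> tuples S n" "i < n" "x \<in> S"
    then show "f (z # xs[i := scl c x]) = sclb c (f (z # xs[i := x]))"
      using scl[of "z # xs" "Suc i" x c] by simp
  next
    fix us x y assume "us \<in> tuples S n" "x \<in> S" "y \<in> S"
    then show "f ((x + y) # us) = f (x # us) + f (y # us)"
      using add[of "x # us" 0 x y] by simp
  next
    fix us c x assume "us \<in> tuples S n" "x \<in> S"
    then show "f (scl c x # us) = sclb c (f (x # us))"
      using scl[of "x # us" 0 x c] by simp
  qed
next
  assume R: ?R
  show ?L
    unfolding multilinear_on_def
  proof (intro conjI ballI allI impI)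
    fix xs i x y assume a: "xs \<in> tuples S (Suc n)" "i < Suc n" "x \<in> S" "y \<in> S"
    obtain z zs where z: "xs = z # zs" "z \<in> S" "zs \<in> tuples S n"
      using a by (auto simp: tuples_Suc)
    show "f (xs[i := x + y]) = f (xs[i := x]) + f (xs[i := y])"
      using R a z by (cases i) (auto simp: multilinear_on_def)
  next
    fix xs i c x assume a: "xs \<in> tuples S (Suc n)" "i < Suc n" "x \<in> S"
    obtain z zs where z: "xs = z # zs" "z \<in> S" "zs \<in> tuples S n"
      using a by (auto simp: tuples_Suc)
    show "f (xs[i := scl c x]) = sclb c (f (xs[i := x]))"
      using R a z by (cases i) (auto simp: multilinear_on_def)
  qed
qed

lemma multilinear_on_mono:
  "multilinear_on scl sclb S n f \<Longrightarrow> S' \<subseteq> S \<Longrightarrow> multilinear_on scl sclb S' n f"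
  unfolding multilinear_on_def tuples_def by blast

lemma list_update_in_tuples: "xs \<in> tuples S n \<Longrightarrow> x \<in> S \<Longrightarrow> xs[i := x] \<in> tuples S n"
  unfolding tuples_def using set_update_subset_insert[of xs i x] by auto

lemma hochschild_cochains_iff:
  "f \<in> hochschild_cochains scale S n \<longleftrightarrow>
     (\<forall>xs\<in>tuples S n. f xs \<in> S) \<and> (\<forall>xs. xs \<notin> tuples S n \<longrightarrow> f xs = 0) \<and>
     multilinear_on scale scale S n f"
  unfolding hochschild_cochains_def multilinear_on_def by blast

text \<open>The part of the Hochschild coboundary that multiplies adjacent entries or multiplies the
  value on the right, up to an overall sign. Recursion over the list replaces the alternating sum
  by a chain of subtractions, so that computations with transfers involve no signs or positions.\<close>

fun tail_coboundary :: "('a list \<Rightarrow> 'a) \<Rightarrow> 'a list \<Rightarrow> 'a::{ring, monoid_mult}" where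
  "tail_coboundary f [] = 0"
| "tail_coboundary f [x] = f [] * x"
| "tail_coboundary f (x # y # zs) =
     f ((x * y) # zs) - tail_coboundary (\<lambda>us. f (x # us)) (y # zs)"

lemma tail_coboundary_cong:
  assumes "\<And>x y. x \<in> T \<Longrightarrow> y \<in> T \<Longrightarrow> x * y \<in> T"
    and "xs \<in> tuples T (Suc n)" "\<And>us. us \<in> tuples T n \<Longrightarrow> f us = g us"
  shows "tail_coboundary f xs = tail_coboundary g xs"
  using assms(2,3)
proof (induction n arbitrary: f g xs)
  case 0
  then show ?case by (auto simp: tuples_Suc)
next
  case (Suc n)
  obtain x y zs where xs: "xs = x # y # zs" "x \<in> T" "y \<in> T" "zs \<in> tuples T n"
    using Suc.prems(1) by (auto simp: tuples_Suc[of _ _ "Suc _"] tuples_Suc[of _ _ n])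
  have "tail_coboundary (\<lambda>us. f (x # us)) (y # zs) = tail_coboundary (\<lambda>us. g (x # us)) (y # zs)"
    by (rule Suc.IH) (use xs Suc.prems(2) in auto)
  then show ?case using Suc.prems(2) xs assms(1) by simp
qed

lemma tail_coboundary_add:
  "tail_coboundary (\<lambda>us. f us + g us) xs = tail_coboundary f xs + tail_coboundary g xs"
  by (induction f xs arbitrary: g rule: tail_coboundary.induct)
    (simp_all add: distrib_right add_diff_add)

lemma tail_coboundary_diff:
  "tail_coboundary (\<lambda>us. f us - g us) xs = tail_coboundary f xs - tail_coboundary g xs"
proof (induction f xs arbitrary: g rule: tail_coboundary.induct)
  case (3 f x y zs)
  show ?case
    using "3.IH"[of "\<lambda>us. g (x # us)"] by simp
qed (simp_all add: left_diff_distrib)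

lemma tail_coboundary_zero: "tail_coboundary (\<lambda>us. 0) xs = 0"
  using tail_coboundary_diff[of "\<lambda>us. 0" "\<lambda>us. 0" xs] by simp

lemma tail_coboundary_sum:
  "tail_coboundary (\<lambda>us. \<Sum>l\<in>L. f l us) xs = (\<Sum>l\<in>L. tail_coboundary (f l) xs)"
  by (induction L rule: infinite_finite_induct)
    (simp_all add: tail_coboundary_add tail_coboundary_zero)

lemma tail_coboundary_mult_left:
  "tail_coboundary (\<lambda>us. y * f us) xs = y * tail_coboundary f xs"
  by (induction f xs rule: tail_coboundary.induct) (simp_all add: algebra_simps)

lemma hochschild_b_outside: "xs \<notin> tuples S (Suc n) \<Longrightarrow> hochschild_b scale S n f xs = 0"
  by (simp add: hochschild_b_def)

context algebra_over_field
begin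

lemma tail_coboundary_eq_sum:
  assumes "length xs = Suc n"
  shows "tail_coboundary f xs =
    (\<Sum>i<n. scale ((- 1) ^ i) (f (take i xs @ (xs ! i * xs ! Suc i) # drop (i + 2) xs)))
    + scale ((- 1) ^ n) (f (butlast xs) * last xs)"
  using assms
proof (induction f xs arbitrary: n rule: tail_coboundary.induct)
  case (3 f x y zs)
  then obtain n' where n: "n = Suc n'" "length zs = n'" by auto
  show ?case
    using "3.IH"[of n'] n
    by (simp add: sum.lessThan_Suc_shift scale_sum_right[symmetric] sum_negf del: sum.lessThan_Suc)
qed simp_all

lemma hochschild_b_Cons:
  assumes "x \<in> S" "xs \<in> tuples S n"
  shows "hochschild_b scale S n f (x # xs) = x * f xs - tail_coboundary f (x # xs)"
proof -
  have "length (x # xs) = Suc n" using assms by (simp add: tuples_def)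
  from tail_coboundary_eq_sum[OF this, of f] show ?thesis
    using assms by (simp add: hochschild_b_def sum_negf del: butlast.simps last.simps)
qed

lemma hochschild_b_add:
  "hochschild_b scale S n (f + g) = hochschild_b scale S n f + hochschild_b scale S n g"
proof
  fix xs
  show "hochschild_b scale S n (f + g) xs =
      (hochschild_b scale S n f + hochschild_b scale S n g) xs"
  proof (cases "xs \<in> tuples S (Suc n)")
    case True
    then obtain y ys where "xs = y # ys" "y \<in> S" "ys \<in> tuples S n" by (auto simp: tuples_Suc)
    then show ?thesis
      using tail_coboundary_add[of f g "y # ys"]
      by (simp add: hochschild_b_Cons plus_fun_def algebra_simps)
  qed (simp add: hochschild_b_outside)
qed

lemma tail_coboundary_scale:
  "tail_coboundary (\<lambda>us. scale c (f us)) xs = scale c (tail_coboundary f xs)"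
  by (induction f xs rule: tail_coboundary.induct)
    (simp_all add: scale_mult_left scale_right_diff_distrib)

lemma hochschild_b_scale:
  "hochschild_b scale S n (\<lambda>xs. scale c (f xs)) = (\<lambda>xs. scale c (hochschild_b scale S n f xs))"
proof
  fix xs
  show "hochschild_b scale S n (\<lambda>xs. scale c (f xs)) xs = scale c (hochschild_b scale S n f xs)"
  proof (cases "xs \<in> tuples S (Suc n)")
    case True
    then obtain y ys where "xs = y # ys" "y \<in> S" "ys \<in> tuples S n" by (auto simp: tuples_Suc)
    then show ?thesis
      using tail_coboundary_scale[of c f "y # ys"]
      by (simp add: hochschild_b_Cons scale_mult_right scale_right_diff_distrib)
  qed (simp add: hochschild_b_outside)
qed

end

section \<open>Transfer of cochains along a matrix-valued multiplicative map\<close>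

text \<open>The sum of \<open>f(E\<^bsub>\<kappa>(0)\<kappa>(1)\<^esub>(x\<^sub>1), \<dots>, E\<^bsub>\<kappa>(n-1)\<kappa>(n)\<^esub>(x\<^sub>n)) s\<^bsub>\<kappa>(n)\<^esub>\<close> over all paths
  \<open>\<kappa>(0), \<dots>, \<kappa>(n)\<close> in \<open>K\<close> that start at \<open>\<kappa>(0) = \<kappa>\<close>.\<close>

fun path_sum ::
    "'j set \<Rightarrow> ('j \<Rightarrow> 'a) \<Rightarrow> ('j \<Rightarrow> 'j \<Rightarrow> 'a \<Rightarrow> 'a) \<Rightarrow> ('a list \<Rightarrow> 'a) \<Rightarrow>
     'j \<Rightarrow> 'a list \<Rightarrow> 'a::{ring, monoid_mult}" where
  "path_sum K s E f \<kappa> [] = f [] * s \<kappa>"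
| "path_sum K s E f \<kappa> (x # xs) = (\<Sum>\<mu>\<in>K. path_sum K s E (\<lambda>us. f (E \<kappa> \<mu> x # us)) \<mu> xs)"

definition transfer ::
    "'a set \<Rightarrow> 'j set \<Rightarrow> ('j \<Rightarrow> 'a) \<Rightarrow> ('j \<Rightarrow> 'a) \<Rightarrow> ('j \<Rightarrow> 'j \<Rightarrow> 'a \<Rightarrow> 'a) \<Rightarrow>
     nat \<Rightarrow> ('a list \<Rightarrow> 'a) \<Rightarrow> 'a list \<Rightarrow> 'a::{ring, monoid_mult}" where
  "transfer T K s s' E n f =
     (\<lambda>xs. if xs \<in> tuples T n then \<Sum>\<kappa>\<in>K. s' \<kappa> * path_sum K s E f \<kappa> xs else 0)"

lemma path_sum_add:
  "path_sum K s E (\<lambda>us. f us + g us) \<kappa> xs = path_sum K s E f \<kappa> xs + path_sum K s E g \<kappa> xs"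
  by (induction xs arbitrary: f g \<kappa>) (simp_all add: distrib_right sum.distrib)

lemma path_sum_diff:
  "path_sum K s E (\<lambda>us. f us - g us) \<kappa> xs = path_sum K s E f \<kappa> xs - path_sum K s E g \<kappa> xs"
  by (induction xs arbitrary: f g \<kappa>) (simp_all add: left_diff_distrib sum_subtractf)

lemma path_sum_zero: "path_sum K s E (\<lambda>us. 0) \<kappa> xs = 0"
  using path_sum_diff[of K s E "\<lambda>us. 0" "\<lambda>us. 0"] by simp

lemma path_sum_sum:
  "path_sum K s E (\<lambda>us. \<Sum>l\<in>L. f l us) \<kappa> xs = (\<Sum>l\<in>L. path_sum K s E (f l) \<kappa> xs)"
  by (induction L rule: infinite_finite_induct) (simp_all add: path_sum_add path_sum_zero)

lemma path_sum_mult_left: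
  "path_sum K s E (\<lambda>us. y * f us) \<kappa> xs = y * path_sum K s E f \<kappa> xs"
  by (induction xs arbitrary: f \<kappa>) (simp_all add: sum_distrib_left mult.assoc)

text \<open>Only the values of \<open>f\<close> on lists over the range of \<open>E\<close> matter. Besides its use in computations, this
  is what allows a cochain of the whole algebra to be replaced by its restriction in a transfer.\<close>

lemma path_sum_cong:
  assumes "\<And>\<kappa> \<mu> x. \<kappa> \<in> K \<Longrightarrow> \<mu> \<in> K \<Longrightarrow> x \<in> T \<Longrightarrow> E \<kappa> \<mu> x \<in> S"
    and "xs \<in> tuples T n" "\<kappa> \<in> K"
    and "\<And>us. us \<in> tuples S n \<Longrightarrow> f us = g us"
  shows "path_sum K s E f \<kappa> xs = path_sum K s E g \<kappa> xs"
  using assms(2-4)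
proof (induction xs arbitrary: f g \<kappa> n)
  case Nil
  then show ?case by (simp add: tuples_def)
next
  case (Cons x xs)
  then obtain n' where n: "n = Suc n'" "x \<in> T" "xs \<in> tuples T n'"
    by (cases n) (auto simp: tuples_def)
  show ?case
    unfolding path_sum.simps
    by (rule sum.cong[OF refl], rule Cons.IH[of n']) (use n Cons.prems assms(1) in auto)
qed

lemma transfer_cong:
  assumes "\<And>\<kappa> \<mu> x. \<kappa> \<in> K \<Longrightarrow> \<mu> \<in> K \<Longrightarrow> x \<in> T \<Longrightarrow> E \<kappa> \<mu> x \<in> S"
    and "\<And>us. us \<in> tuples S n \<Longrightarrow> f us = g us"
  shows "transfer T K s s' E n f = transfer T K s s' E n g"
proof
  fix xs
  have "path_sum K s E f \<kappa> xs = path_sum K s E g \<kappa> xs" if "xs \<in> tuples T n" "\<kappa> \<in> K" for \<kappa>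
    using that assms by (intro path_sum_cong[of K T E S xs n]) auto
  then show "transfer T K s s' E n f xs = transfer T K s s' E n g xs"
    by (simp add: transfer_def)
qed

lemma transfer_add:
  "transfer T K s s' E n (f + g) = transfer T K s s' E n f + transfer T K s s' E n g"
  by (auto simp: transfer_def plus_fun_def path_sum_add distrib_left sum.distrib)

context algebra_over_field
begin

lemma multilinear_on_sum:
  assumes "\<And>l. l \<in> L \<Longrightarrow> multilinear_on scale scale S n (f l)"
  shows "multilinear_on scale scale S n (\<lambda>us. \<Sum>l\<in>L. f l us)"
  using assms unfolding multilinear_on_def
  by (auto simp: sum.distrib[symmetric] scale_sum_right intro!: sum.cong)

lemma multilinear_on_diff:
  assumes "multilinear_on scale scale S n f" "multilinear_on scale scale S n g"
  shows "multilinear_on scale scale S n (\<lambda>us. f us - g us)"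
  using assms unfolding multilinear_on_def
  by (auto simp: scale_right_diff_distrib)

lemma multilinear_on_mult_left:
  assumes "multilinear_on scale scale S n f"
  shows "multilinear_on scale scale S n (\<lambda>us. y * f us)"
  using assms unfolding multilinear_on_def
  by (auto simp: scale_mult_right distrib_left)

lemma multilinear_on_Cons_sum:
  assumes "multilinear_on scale scale S (Suc n) f" "subspace S" "us \<in> tuples S n"
    and "\<And>l. l \<in> L \<Longrightarrow> g l \<in> S"
  shows "f ((\<Sum>l\<in>L. g l) # us) = (\<Sum>l\<in>L. f (g l # us))"
proof -
  have zero: "f (0 # us) = 0"
    using assms by (auto simp: multilinear_on_Suc dest!: subspace_0 bspec[of _ _ us] spec[of _ 0])
  show ?thesis
    using assms(4)
  proof (induction L rule: infinite_finite_induct)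
    case (insert l L)
    then have "(\<Sum>l\<in>L. g l) \<in> S" by (intro subspace_sum[OF assms(2)]) auto
    then show ?case using insert assms(1,3) by (auto simp: multilinear_on_Suc)
  qed (simp_all add: zero)
qed

lemma multilinear_on_restrict:
  assumes "multilinear_on scale scale S n f" "subspace S"
  shows "multilinear_on scale scale S n (\<lambda>us. if us \<in> tuples S n then f us else 0)"
  unfolding multilinear_on_def
proof (intro conjI ballI allI impI)
  fix us i x y assume a: "us \<in> tuples S n" "i < n" "x \<in> S" "y \<in> S"
  then show "(if us[i := x + y] \<in> tuples S n then f (us[i := x + y]) else 0) =
      (if us[i := x] \<in> tuples S n then f (us[i := x]) else 0) +
      (if us[i := y] \<in> tuples S n then f (us[i := y]) else 0)"
    using assms(1) list_update_in_tuples[OF a(1)] subspace_add[OF assms(2) a(3,4)]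
    by (simp add: multilinear_on_def)
next
  fix us i c x assume a: "us \<in> tuples S n" "i < n" "x \<in> S"
  then show "(if us[i := scale c x] \<in> tuples S n then f (us[i := scale c x]) else 0) =
      scale c (if us[i := x] \<in> tuples S n then f (us[i := x]) else 0)"
    using assms(1) list_update_in_tuples[OF a(1)] subspace_scale[OF assms(2) a(3)]
    by (simp add: multilinear_on_def)
qed

lemma path_sum_scale:
  "path_sum K s E (\<lambda>us. scale c (f us)) \<kappa> xs = scale c (path_sum K s E f \<kappa> xs)"
  by (induction xs arbitrary: f \<kappa>) (simp_all add: scale_mult_left scale_sum_right)

end

text \<open>The last assumption says that \<open>E\<close> is multiplicative as a map from \<open>T\<close> to matrices over \<open>S\<close>; the two
  before it say that the column \<open>s\<close> and the row \<open>s'\<close> intertwine this map with the multiplication of the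
  algebra.\<close>

locale matrix_map = algebra_over_field scale
  for scale :: "'k::field \<Rightarrow> 'a::{ring, monoid_mult} \<Rightarrow> 'a" +
  fixes T S :: "'a set" and K :: "'j set" and s s' :: "'j \<Rightarrow> 'a" and E :: "'j \<Rightarrow> 'j \<Rightarrow> 'a \<Rightarrow> 'a"
  assumes subspace_T: "subspace T"
    and subspace_S: "subspace S"
    and mult_S: "x \<in> S \<Longrightarrow> y \<in> S \<Longrightarrow> x * y \<in> S"
    and mult_T: "x \<in> T \<Longrightarrow> y \<in> T \<Longrightarrow> x * y \<in> T"
    and E_in: "\<kappa> \<in> K \<Longrightarrow> \<mu> \<in> K \<Longrightarrow> x \<in> T \<Longrightarrow> E \<kappa> \<mu> x \<in> S"
    and E_add: "E \<kappa> \<mu> (x + y) = E \<kappa> \<mu> x + E \<kappa> \<mu> y"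
    and E_scale: "E \<kappa> \<mu> (scale c x) = scale c (E \<kappa> \<mu> x)"
    and E_left: "\<mu> \<in> K \<Longrightarrow> x \<in> T \<Longrightarrow> (\<Sum>\<kappa>\<in>K. s' \<kappa> * E \<kappa> \<mu> x) = x * s' \<mu>"
    and E_right: "\<kappa> \<in> K \<Longrightarrow> x \<in> T \<Longrightarrow> (\<Sum>\<mu>\<in>K. E \<kappa> \<mu> x * s \<mu>) = s \<kappa> * x"
    and E_mult: "\<kappa> \<in> K \<Longrightarrow> \<nu> \<in> K \<Longrightarrow> x \<in> T \<Longrightarrow> y \<in> T \<Longrightarrow>
      (\<Sum>\<mu>\<in>K. E \<kappa> \<mu> x * E \<mu> \<nu> y) = E \<kappa> \<nu> (x * y)"
begin

abbreviation paths where "paths \<equiv> path_sum K s E"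

lemma multilinear_on_path_sum:
  "multilinear_on scale scale S n f \<Longrightarrow> \<kappa> \<in> K \<Longrightarrow> multilinear_on scale scale T n (paths f \<kappa>)"
proof (induction n arbitrary: f \<kappa>)
  case (Suc n)
  note f = Suc.prems(1)[unfolded multilinear_on_Suc]
  show ?case
    unfolding multilinear_on_Suc path_sum.simps
  proof (intro conjI ballI allI)
    fix x assume "x \<in> T"
    then show "multilinear_on scale scale T n
        (\<lambda>us. \<Sum>\<mu>\<in>K. paths (\<lambda>us. f (E \<kappa> \<mu> x # us)) \<mu> us)"
      using f E_in Suc.prems(2) by (intro multilinear_on_sum Suc.IH) auto
  next
    fix us x y assume a: "us \<in> tuples T n" "x \<in> T" "y \<in> T"
    have "paths (\<lambda>us. f (E \<kappa> \<mu> (x + y) # us)) \<mu> us =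
        paths (\<lambda>us. f (E \<kappa> \<mu> x # us) + f (E \<kappa> \<mu> y # us)) \<mu> us" if "\<mu> \<in> K" for \<mu>
      by (rule path_sum_cong[of K T E S _ n]) (use a that f E_in Suc.prems(2) in \<open>auto simp: E_add\<close>)
    then show "(\<Sum>\<mu>\<in>K. paths (\<lambda>us. f (E \<kappa> \<mu> (x + y) # us)) \<mu> us) =
        (\<Sum>\<mu>\<in>K. paths (\<lambda>us. f (E \<kappa> \<mu> x # us)) \<mu> us) +
        (\<Sum>\<mu>\<in>K. paths (\<lambda>us. f (E \<kappa> \<mu> y # us)) \<mu> us)"
      by (simp add: path_sum_add sum.distrib[symmetric])
  next
    fix us c x assume a: "us \<in> tuples T n" "x \<in> T"
    have "paths (\<lambda>us. f (E \<kappa> \<mu> (scale c x) # us)) \<mu> us =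
        paths (\<lambda>us. scale c (f (E \<kappa> \<mu> x # us))) \<mu> us" if "\<mu> \<in> K" for \<mu>
      by (rule path_sum_cong[of K T E S _ n]) (use a that f E_in Suc.prems(2) in \<open>auto simp: E_scale\<close>)
    then show "(\<Sum>\<mu>\<in>K. paths (\<lambda>us. f (E \<kappa> \<mu> (scale c x) # us)) \<mu> us) =
        scale c (\<Sum>\<mu>\<in>K. paths (\<lambda>us. f (E \<kappa> \<mu> x # us)) \<mu> us)"
      by (simp add: path_sum_scale scale_sum_right)
  qed
qed simp

text \<open>Merging two adjacent arguments commutes with the sum over paths because the sum over the middle index
  of \<open>E\<^bsub>\<kappa>\<mu>\<^esub>(x) E\<^bsub>\<mu>\<nu>\<^esub>(y)\<close> is \<open>E\<^bsub>\<kappa>\<nu>\<^esub>(x y)\<close>; at the right end \<open>s\<close> absorbs the last argument.\<close>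

lemma path_sum_tail_coboundary:
  "multilinear_on scale scale S n f \<Longrightarrow> \<kappa> \<in> K \<Longrightarrow> xs \<in> tuples T (Suc n) \<Longrightarrow>
   paths (tail_coboundary f) \<kappa> xs = tail_coboundary (paths f \<kappa>) xs"
proof (induction n arbitrary: f \<kappa> xs)
  case 0
  then obtain x where "xs = [x]" "x \<in> T" by (auto simp: tuples_Suc)
  then show ?case
    using 0 by (simp add: E_right mult.assoc sum_distrib_left[symmetric])
next
  case (Suc n)
  obtain x y zs where xs: "xs = x # y # zs" "x \<in> T" "y \<in> T" "zs \<in> tuples T n"
    using Suc.prems by (auto simp: tuples_Suc[of _ _ "Suc _"] tuples_Suc[of _ _ n])
  note f = Suc.prems(1)[unfolded multilinear_on_Suc]
  let ?g = "\<lambda>\<mu> us. f (E \<kappa> \<mu> x # us)"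
  have merged: "(\<Sum>\<mu>\<in>K. paths (\<lambda>us. f ((E \<kappa> \<mu> x * E \<mu> \<nu> y) # us)) \<nu> zs) =
      paths (\<lambda>us. f (E \<kappa> \<nu> (x * y) # us)) \<nu> zs" if "\<nu> \<in> K" for \<nu>
    unfolding path_sum_sum[symmetric]
  proof (rule path_sum_cong[of K T E S zs n])
    fix us assume us: "us \<in> tuples S n"
    have "(\<Sum>\<mu>\<in>K. f ((E \<kappa> \<mu> x * E \<mu> \<nu> y) # us)) = f ((\<Sum>\<mu>\<in>K. E \<kappa> \<mu> x * E \<mu> \<nu> y) # us)"
      by (rule multilinear_on_Cons_sum[OF Suc.prems(1) subspace_S us, symmetric])
        (use E_in mult_S xs that Suc.prems in auto)
    then show "(\<Sum>\<mu>\<in>K. f ((E \<kappa> \<mu> x * E \<mu> \<nu> y) # us)) = f (E \<kappa> \<nu> (x * y) # us)"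
      using E_mult xs that Suc.prems by simp
  qed (use E_in xs that in auto)
  have rest: "paths (tail_coboundary (?g \<mu>)) \<mu> (y # zs) = tail_coboundary (paths (?g \<mu>) \<mu>) (y # zs)"
    if "\<mu> \<in> K" for \<mu>
    using that f E_in xs Suc.prems by (intro Suc.IH) auto
  have "paths (tail_coboundary f) \<kappa> xs =
      (\<Sum>\<mu>\<in>K. \<Sum>\<nu>\<in>K. paths (\<lambda>us. f ((E \<kappa> \<mu> x * E \<mu> \<nu> y) # us)) \<nu> zs) -
      (\<Sum>\<mu>\<in>K. paths (tail_coboundary (?g \<mu>)) \<mu> (y # zs))"
    by (simp add: xs path_sum_diff sum_subtractf)
  also have "(\<Sum>\<mu>\<in>K. \<Sum>\<nu>\<in>K. paths (\<lambda>us. f ((E \<kappa> \<mu> x * E \<mu> \<nu> y) # us)) \<nu> zs) =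
      paths f \<kappa> ((x * y) # zs)"
    by (subst sum.swap) (simp add: merged)
  also have "(\<Sum>\<mu>\<in>K. paths (tail_coboundary (?g \<mu>)) \<mu> (y # zs)) =
      tail_coboundary (\<lambda>us. paths f \<kappa> (x # us)) (y # zs)"
    by (simp add: rest tail_coboundary_sum del: path_sum.simps(2) add: path_sum.simps(2)[of K s E f])
  finally show ?case by (simp add: xs)
qed

lemma transfer_in_cochains:
  assumes "multilinear_on scale scale S n f"
    and "\<And>xs. xs \<in> tuples T n \<Longrightarrow> transfer T K s s' E n f xs \<in> T"
  shows "transfer T K s s' E n f \<in> hochschild_cochains scale T n"
  unfolding hochschild_cochains_iff
proof (intro conjI ballI allI impI)
  show "multilinear_on scale scale T n (transfer T K s s' E n f)"
    unfolding transfer_def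
    by (intro multilinear_on_restrict multilinear_on_sum multilinear_on_mult_left
        multilinear_on_path_sum assms(1) subspace_T)
qed (rule assms(2), assumption, simp add: transfer_def)

text \<open>At the left end, \<open>s'\<close> absorbs the first argument; the rest is the previous commutation.\<close>

lemma transfer_chain_map:
  assumes f: "f \<in> hochschild_cochains scale S n"
  shows "hochschild_b scale T n (transfer T K s s' E n f) =
    transfer T K s s' E (Suc n) (hochschild_b scale S n f)"
proof
  fix xs
  have ml: "multilinear_on scale scale S n f" using f by (simp add: hochschild_cochains_iff)
  show "hochschild_b scale T n (transfer T K s s' E n f) xs =
      transfer T K s s' E (Suc n) (hochschild_b scale S n f) xs"
  proof (cases "xs \<in> tuples T (Suc n)")
    case True
    then obtain x us where xs: "xs = x # us" "x \<in> T" "us \<in> tuples T n" by (auto simp: tuples_Suc)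
    have "paths (hochschild_b scale S n f) \<kappa> xs =
        (\<Sum>\<mu>\<in>K. E \<kappa> \<mu> x * paths f \<mu> us) - paths (tail_coboundary f) \<kappa> xs"
      if "\<kappa> \<in> K" for \<kappa>
    proof -
      have "paths (\<lambda>us. hochschild_b scale S n f (E \<kappa> \<mu> x # us)) \<mu> us =
          paths (\<lambda>us. E \<kappa> \<mu> x * f us - tail_coboundary f (E \<kappa> \<mu> x # us)) \<mu> us"
        if "\<mu> \<in> K" for \<mu>
        by (rule path_sum_cong[of K T E S us n])
          (use that \<open>\<kappa> \<in> K\<close> E_in xs in \<open>auto simp: hochschild_b_Cons\<close>)
      then show ?thesis
        by (simp add: xs path_sum_diff path_sum_mult_left sum_subtractf)
    qed
    then have "transfer T K s s' E (Suc n) (hochschild_b scale S n f) xs =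
        (\<Sum>\<kappa>\<in>K. \<Sum>\<mu>\<in>K. s' \<kappa> * E \<kappa> \<mu> x * paths f \<mu> us) -
        (\<Sum>\<kappa>\<in>K. s' \<kappa> * paths (tail_coboundary f) \<kappa> xs)"
      using True by (simp add: transfer_def right_diff_distrib sum_subtractf sum_distrib_left mult.assoc)
    also have "(\<Sum>\<kappa>\<in>K. \<Sum>\<mu>\<in>K. s' \<kappa> * E \<kappa> \<mu> x * paths f \<mu> us) =
        x * (\<Sum>\<mu>\<in>K. s' \<mu> * paths f \<mu> us)"
    proof -
      have "(\<Sum>\<kappa>\<in>K. s' \<kappa> * E \<kappa> \<mu> x * paths f \<mu> us) = x * (s' \<mu> * paths f \<mu> us)"
        if "\<mu> \<in> K" for \<mu>
        using E_left[OF that xs(2)] by (simp add: sum_distrib_right[symmetric] mult.assoc[symmetric])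
      then show ?thesis
        by (subst sum.swap) (simp add: sum_distrib_left)
    qed
    also have "(\<Sum>\<kappa>\<in>K. s' \<kappa> * paths (tail_coboundary f) \<kappa> xs) =
        tail_coboundary (\<lambda>us. \<Sum>\<kappa>\<in>K. s' \<kappa> * paths f \<kappa> us) xs"
      using True ml by (simp add: tail_coboundary_sum tail_coboundary_mult_left path_sum_tail_coboundary)
    also have "\<dots> = tail_coboundary (transfer T K s s' E n f) xs"
      by (rule tail_coboundary_cong[OF mult_T True]) (simp_all add: transfer_def)
    finally show ?thesis
      using xs by (simp add: hochschild_b_Cons transfer_def)
  qed (simp add: hochschild_b_outside transfer_def)
qed

end

section \<open>Transfers are homotopic to a multiple of the identity\<close>

text \<open>The alternating sum, over all positions \<open>l\<close>, of the terms
  \<open>f(E(x\<^sub>1), \<dots>, E(x\<^sub>l), s, x\<^bsub>l+1\<^esub>, \<dots>, x\<^sub>n)\<close> with the path summed from \<open>\<kappa>\<close> up to the inserted \<open>s\<close>. It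
  interpolates between the list with no argument replaced and the one with all arguments replaced.\<close>

fun insertion_sum ::
    "'j set \<Rightarrow> ('j \<Rightarrow> 'a) \<Rightarrow> ('j \<Rightarrow> 'j \<Rightarrow> 'a \<Rightarrow> 'a) \<Rightarrow> ('a list \<Rightarrow> 'a) \<Rightarrow>
     'j \<Rightarrow> 'a list \<Rightarrow> 'a::{ring, monoid_mult}" where
  "insertion_sum K s E f \<kappa> [] = f [s \<kappa>]"
| "insertion_sum K s E f \<kappa> (x # xs) =
     f (s \<kappa> # x # xs) - (\<Sum>\<mu>\<in>K. insertion_sum K s E (\<lambda>us. f (E \<kappa> \<mu> x # us)) \<mu> xs)"

lemma insertion_sum_cong:
  assumes "\<And>us. length us = Suc (length xs) \<Longrightarrow> f us = g us"
  shows "insertion_sum K s E f \<kappa> xs = insertion_sum K s E g \<kappa> xs"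
  using assms
proof (induction xs arbitrary: f g \<kappa>)
  case (Cons x xs)
  have "insertion_sum K s E (\<lambda>us. f (E \<kappa> \<mu> x # us)) \<mu> xs =
      insertion_sum K s E (\<lambda>us. g (E \<kappa> \<mu> x # us)) \<mu> xs" for \<mu>
    by (rule Cons.IH) (simp add: Cons.prems)
  then show ?case by (simp add: Cons.prems)
qed simp

lemma insertion_sum_diff:
  "insertion_sum K s E (\<lambda>us. f us - g us) \<kappa> xs =
     insertion_sum K s E f \<kappa> xs - insertion_sum K s E g \<kappa> xs"
  by (induction xs arbitrary: f g \<kappa>) (simp_all add: sum_subtractf)

lemma insertion_sum_zero: "insertion_sum K s E (\<lambda>us. 0) \<kappa> xs = 0"
  using insertion_sum_diff[of K s E "\<lambda>us. 0" "\<lambda>us. 0"] by simp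

lemma insertion_sum_add:
  "insertion_sum K s E (\<lambda>us. f us + g us) \<kappa> xs =
     insertion_sum K s E f \<kappa> xs + insertion_sum K s E g \<kappa> xs"
  using insertion_sum_diff[of K s E "\<lambda>us. f us + g us" g \<kappa> xs] by simp

lemma insertion_sum_sum:
  "insertion_sum K s E (\<lambda>us. \<Sum>l\<in>L. f l us) \<kappa> xs = (\<Sum>l\<in>L. insertion_sum K s E (f l) \<kappa> xs)"
  by (induction L rule: infinite_finite_induct) (simp_all add: insertion_sum_add insertion_sum_zero)

lemma insertion_sum_mult_left:
  "insertion_sum K s E (\<lambda>us. y * f us) \<kappa> xs = y * insertion_sum K s E f \<kappa> xs"
  by (induction xs arbitrary: f \<kappa>) (simp_all add: right_diff_distrib sum_distrib_left)

lemma tuples_UNIV [simp]: "xs \<in> tuples UNIV n \<longleftrightarrow> length xs = n"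
  by (simp add: tuples_def)

context algebra_over_field
begin

lemma insertion_sum_scale:
  "insertion_sum K s E (\<lambda>us. scale c (f us)) \<kappa> xs = scale c (insertion_sum K s E f \<kappa> xs)"
  by (induction xs arbitrary: f \<kappa>) (simp_all add: scale_right_diff_distrib scale_sum_right)

end

context matrix_map
begin

text \<open>The prism identity. Merging the inserted \<open>s\<close> with its left neighbour \<open>E(x)\<close> and merging the \<open>s\<close>
  inserted one position earlier with its right neighbour \<open>x\<close> give the same terms with
  opposite signs, since \<open>\<Sum>\<^bsub>\<mu>\<^esub> E\<^bsub>\<kappa>\<mu>\<^esub>(x) s\<^bsub>\<mu>\<^esub> = s\<^bsub>\<kappa>\<^esub> x\<close>. What survives is the term in which \<open>s\<close> has
  been pushed past all the arguments.\<close>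

lemma insertion_sum_prism:
  assumes "T = UNIV" "S = UNIV"
  shows "multilinear_on scale scale UNIV n f \<Longrightarrow> \<kappa> \<in> K \<Longrightarrow> length xs = n \<Longrightarrow>
    insertion_sum K s E (tail_coboundary f) \<kappa> xs + tail_coboundary (insertion_sum K s E f \<kappa>) xs =
    paths f \<kappa> xs"
proof (induction n arbitrary: f \<kappa> xs)
  case 0
  then show ?case by simp
next
  case (Suc n)
  let ?H = "insertion_sum K s E"
  obtain x ys where xs: "xs = x # ys" "length ys = n"
    using Suc.prems(3) by (cases xs) auto
  have Cons_sum: "(\<Sum>l\<in>L. f (g l # us)) = f ((\<Sum>l\<in>L. g l) # us)"
    if "length us = n" for L us and g :: "'j \<Rightarrow> 'a"
    by (rule multilinear_on_Cons_sum[OF Suc.prems(1), symmetric]) (simp_all add: that)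
  let ?g = "\<lambda>\<mu> us. f (E \<kappa> \<mu> x # us)"
  let ?k = "\<lambda>\<mu> us. f ((E \<kappa> \<mu> x * hd us) # tl us)"
  have g: "multilinear_on scale scale UNIV n (?g \<mu>)" for \<mu>
    using Suc.prems(1) by (simp add: multilinear_on_Suc)
  have split: "?H (\<lambda>us. tail_coboundary f (E \<kappa> \<mu> x # us)) \<mu> ys =
      ?H (?k \<mu>) \<mu> ys - ?H (tail_coboundary (?g \<mu>)) \<mu> ys" for \<mu>
    unfolding insertion_sum_diff[symmetric]
  proof (rule insertion_sum_cong)
    fix us :: "'a list" assume "length us = Suc (length ys)"
    then obtain v vs where "us = v # vs" by (cases us) auto
    then show "tail_coboundary f (E \<kappa> \<mu> x # us) = ?k \<mu> us - tail_coboundary (?g \<mu>) us"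
      by simp
  qed
  have IH: "?H (tail_coboundary (?g \<mu>)) \<mu> ys =
      paths (?g \<mu>) \<mu> ys - tail_coboundary (?H (?g \<mu>) \<mu>) ys" if "\<mu> \<in> K" for \<mu>
    using Suc.IH[OF g that xs(2)] by (simp add: eq_diff_eq)
  \<comment> \<open>The tail coboundary either merges the first two entries or leaves the first one alone; in the
    latter case the induction hypothesis applies.\<close>
  have start: "?H (tail_coboundary f) \<kappa> xs = tail_coboundary f (s \<kappa> # x # ys)
      - (\<Sum>\<mu>\<in>K. ?H (?k \<mu>) \<mu> ys) + (paths f \<kappa> xs - (\<Sum>\<mu>\<in>K. tail_coboundary (?H (?g \<mu>) \<mu>) ys))"
    by (simp add: xs split IH sum_subtractf del: tail_coboundary.simps)
  show ?case
  proof (cases ys)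
    case Nil
    have "(\<Sum>\<mu>\<in>K. ?H (?k \<mu>) \<mu> ys) = f [s \<kappa> * x]"
      using E_right[OF Suc.prems(2), of x] xs Nil assms by (simp add: Cons_sum)
    then show ?thesis
      using start by (simp add: Nil xs)
  next
    case (Cons y zs)
    have merged: "(\<Sum>\<mu>\<in>K. ?H (\<lambda>us. ?k \<mu> (E \<mu> \<nu> y # us)) \<nu> zs) =
        ?H (\<lambda>us. f (E \<kappa> \<nu> (x * y) # us)) \<nu> zs" if "\<nu> \<in> K" for \<nu>
      unfolding insertion_sum_sum[symmetric]
    proof (rule insertion_sum_cong)
      fix us :: "'a list" assume us: "length us = Suc (length zs)"
      then show "(\<Sum>\<mu>\<in>K. ?k \<mu> (E \<mu> \<nu> y # us)) = f (E \<kappa> \<nu> (x * y) # us)"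
        using E_mult[OF Suc.prems(2) that, of x y] xs Cons assms by (simp add: Cons_sum)
    qed
    have "(\<Sum>\<mu>\<in>K. ?H (?k \<mu>) \<mu> ys) =
        (\<Sum>\<mu>\<in>K. f ((E \<kappa> \<mu> x * s \<mu>) # ys)) - (\<Sum>\<nu>\<in>K. \<Sum>\<mu>\<in>K. ?H (\<lambda>us. ?k \<mu> (E \<mu> \<nu> y # us)) \<nu> zs)"
      by (subst sum.swap) (simp add: Cons sum_subtractf)
    also have "\<dots> = f ((s \<kappa> * x) # ys) - (f (s \<kappa> # (x * y) # zs) - ?H f \<kappa> ((x * y) # zs))"
      using E_right[OF Suc.prems(2), of x] xs assms by (simp add: Cons_sum merged[simplified])
    finally have k: "(\<Sum>\<mu>\<in>K. ?H (?k \<mu>) \<mu> ys) = \<dots>" .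
    have "tail_coboundary (?H f \<kappa>) xs = ?H f \<kappa> ((x * y) # zs) -
        (tail_coboundary (\<lambda>us. f (s \<kappa> # x # us)) ys - (\<Sum>\<mu>\<in>K. tail_coboundary (?H (?g \<mu>) \<mu>) ys))"
      by (simp add: xs Cons tail_coboundary_diff tail_coboundary_sum)
    then show ?thesis
      unfolding start k by (simp add: Cons)
  qed
qed

lemma multilinear_on_insertion_sum:
  "multilinear_on scale scale UNIV (Suc n) f \<Longrightarrow>
   multilinear_on scale scale UNIV n (insertion_sum K s E f \<kappa>)"
proof (induction n arbitrary: f \<kappa>)
  case (Suc n)
  note f = Suc.prems[unfolded multilinear_on_Suc[of _ _ _ "Suc n"]]
  have f2: "multilinear_on scale scale UNIV (Suc n) (\<lambda>us. f (x # us))" for x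
    using f by auto
  note f3 = f2[unfolded multilinear_on_Suc]
  show ?case
    unfolding multilinear_on_Suc insertion_sum.simps
  proof (intro conjI ballI allI)
    fix x
    show "multilinear_on scale scale UNIV n
        (\<lambda>us. f (s \<kappa> # x # us) - (\<Sum>\<mu>\<in>K. insertion_sum K s E (\<lambda>us. f (E \<kappa> \<mu> x # us)) \<mu> us))"
      using f3 by (intro multilinear_on_diff multilinear_on_sum Suc.IH f2) auto
  next
    fix us :: "'a list" and x y assume us: "us \<in> tuples UNIV n"
    have "insertion_sum K s E (\<lambda>us. f (E \<kappa> \<mu> (x + y) # us)) \<mu> us =
        insertion_sum K s E (\<lambda>us. f (E \<kappa> \<mu> x # us) + f (E \<kappa> \<mu> y # us)) \<mu> us" for \<mu>
      by (rule insertion_sum_cong) (use us f in \<open>auto simp: E_add\<close>)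
    then show "f (s \<kappa> # (x + y) # us) -
        (\<Sum>\<mu>\<in>K. insertion_sum K s E (\<lambda>us. f (E \<kappa> \<mu> (x + y) # us)) \<mu> us) =
        f (s \<kappa> # x # us) - (\<Sum>\<mu>\<in>K. insertion_sum K s E (\<lambda>us. f (E \<kappa> \<mu> x # us)) \<mu> us) +
        (f (s \<kappa> # y # us) - (\<Sum>\<mu>\<in>K. insertion_sum K s E (\<lambda>us. f (E \<kappa> \<mu> y # us)) \<mu> us))"
      using f3 us by (simp add: insertion_sum_add sum.distrib)
  next
    fix us :: "'a list" and c x assume us: "us \<in> tuples UNIV n"
    have "insertion_sum K s E (\<lambda>us. f (E \<kappa> \<mu> (scale c x) # us)) \<mu> us =
        insertion_sum K s E (\<lambda>us. scale c (f (E \<kappa> \<mu> x # us))) \<mu> us" for \<mu>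
      by (rule insertion_sum_cong) (use us f in \<open>auto simp: E_scale\<close>)
    then show "f (s \<kappa> # scale c x # us) -
        (\<Sum>\<mu>\<in>K. insertion_sum K s E (\<lambda>us. f (E \<kappa> \<mu> (scale c x) # us)) \<mu> us) =
        scale c (f (s \<kappa> # x # us) - (\<Sum>\<mu>\<in>K. insertion_sum K s E (\<lambda>us. f (E \<kappa> \<mu> x # us)) \<mu> us))"
      using f3 us by (simp add: insertion_sum_scale scale_sum_right scale_right_diff_distrib)
  qed
qed simp

text \<open>The homotopy is the sum of \<open>s'\<^bsub>\<kappa>\<^esub>\<close> times the insertion sums starting at \<open>\<kappa>\<close>. The left action
  contributes the term with \<open>s\<close> before all the arguments, which is \<open>c f\<close>; the prism identity
  contributes the term with \<open>s\<close> behind them, which is the transfer.\<close>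

theorem transfer_homotopic_multiple:
  assumes "T = UNIV" "S = UNIV" and c: "(\<Sum>\<kappa>\<in>K. s' \<kappa> * s \<kappa>) = scale c 1"
    and f: "f \<in> hochschild_cocycles scale UNIV n"
  shows "(\<lambda>xs. scale c (f xs)) - transfer UNIV K s s' E n f \<in> hochschild_coboundaries scale UNIV n"
proof -
  let ?H = "insertion_sum K s E"
  have ml: "multilinear_on scale scale UNIV n f" and fc: "f \<in> hochschild_cochains scale UNIV n"
    and bf: "hochschild_b scale UNIV n f = 0"
    using f by (auto simp: hochschild_cochains_iff hochschild_cocycles_def)
  have H0: "?H (hochschild_b scale UNIV n f) \<kappa> xs = 0" for \<kappa> xs
    unfolding bf zero_fun_def by (rule insertion_sum_zero)
  have bf': "x * f us = tail_coboundary f (x # us)" if "length us = n" for x us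
    using hochschild_b_Cons[of x UNIV us n f] that bf by simp
  have c': "(\<Sum>\<kappa>\<in>K. s' \<kappa> * (s \<kappa> * y)) = scale c y" for y
    using c by (simp add: mult.assoc[symmetric] sum_distrib_right[symmetric] scale_mult_left)
  show ?thesis
  proof (cases n)
    case 0
    have "(\<lambda>xs. scale c (f xs)) - transfer UNIV K s s' E n f = 0"
    proof
      fix xs
      show "((\<lambda>xs. scale c (f xs)) - transfer UNIV K s s' E n f) xs = 0 xs"
        using c'[of "f []"] bf'[of "[]"] fc 0
        by (cases xs) (simp_all add: transfer_def hochschild_cochains_iff)
    qed
    then show ?thesis using 0 by simp
  next
    case (Suc n')
    define h where "h = (\<lambda>xs. if xs \<in> tuples UNIV n' then \<Sum>\<kappa>\<in>K. s' \<kappa> * ?H f \<kappa> xs else 0)"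
    have hc: "h \<in> hochschild_cochains scale UNIV n'"
      unfolding hochschild_cochains_iff
    proof (intro conjI ballI allI impI)
      show "multilinear_on scale scale UNIV n' h"
        unfolding h_def using ml[unfolded Suc]
        by (intro multilinear_on_restrict multilinear_on_sum multilinear_on_mult_left
            multilinear_on_insertion_sum subspace_UNIV)
    qed (auto simp: h_def)
    have "hochschild_b scale UNIV n' h xs = ((\<lambda>xs. scale c (f xs)) - transfer UNIV K s s' E n f) xs"
      for xs
    proof (cases "length xs = n")
      case True
      then obtain x us where xs: "xs = x # us" "length us = n'" using Suc by (cases xs) auto
      have "?H (tail_coboundary f) \<kappa> xs =
          s \<kappa> * f xs - (\<Sum>\<mu>\<in>K. E \<kappa> \<mu> x * ?H f \<mu> us)" if "\<kappa> \<in> K" for \<kappa>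
      proof -
        have "?H (\<lambda>vs. tail_coboundary f (E \<kappa> \<mu> x # vs)) \<mu> us = ?H (\<lambda>vs. E \<kappa> \<mu> x * f vs) \<mu> us" for \<mu>
          by (rule insertion_sum_cong) (use xs bf' Suc in auto)
        then show ?thesis
          using bf'[of "x # us" "s \<kappa>"] xs Suc by (simp add: insertion_sum_mult_left)
      qed
      then have "(\<Sum>\<kappa>\<in>K. s' \<kappa> * ?H (tail_coboundary f) \<kappa> xs) =
          scale c (f xs) - (\<Sum>\<kappa>\<in>K. \<Sum>\<mu>\<in>K. s' \<kappa> * E \<kappa> \<mu> x * ?H f \<mu> us)"
        by (simp add: right_diff_distrib sum_subtractf c' sum_distrib_left mult.assoc)
      also have "(\<Sum>\<kappa>\<in>K. \<Sum>\<mu>\<in>K. s' \<kappa> * E \<kappa> \<mu> x * ?H f \<mu> us) = x * h us"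
      proof -
        have "(\<Sum>\<kappa>\<in>K. s' \<kappa> * E \<kappa> \<mu> x * ?H f \<mu> us) = x * (s' \<mu> * ?H f \<mu> us)" if "\<mu> \<in> K" for \<mu>
          using E_left[OF that, of x] assms(1)
          by (simp add: sum_distrib_right[symmetric] mult.assoc[symmetric])
        then show ?thesis
          by (subst sum.swap) (simp add: sum_distrib_left h_def xs)
      qed
      finally have 1: "(\<Sum>\<kappa>\<in>K. s' \<kappa> * ?H (tail_coboundary f) \<kappa> xs) = scale c (f xs) - x * h us" .
      have "tail_coboundary h xs = tail_coboundary (\<lambda>us. \<Sum>\<kappa>\<in>K. s' \<kappa> * ?H f \<kappa> us) xs"
        by (rule tail_coboundary_cong[of UNIV _ n']) (use xs in \<open>auto simp: h_def\<close>)
      also have "\<dots> = (\<Sum>\<kappa>\<in>K. s' \<kappa> * tail_coboundary (?H f \<kappa>) xs)"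
        by (simp add: tail_coboundary_sum tail_coboundary_mult_left)
      also have "\<dots> = (\<Sum>\<kappa>\<in>K. s' \<kappa> * paths f \<kappa> xs) - (scale c (f xs) - x * h us)"
        unfolding 1[symmetric] sum_subtractf[symmetric] right_diff_distrib[symmetric]
        using insertion_sum_prism[OF assms(1,2) ml _ True]
        by (intro sum.cong refl arg_cong[of _ _ "(*) _"]) (simp add: eq_diff_eq add.commute)
      finally show ?thesis
        using hochschild_b_Cons[of x UNIV us n' h] xs True by (simp add: transfer_def)
    next
      case False
      then show ?thesis
        using fc Suc by (simp add: hochschild_b_outside transfer_def hochschild_cochains_iff)
    qed
    then have "(\<lambda>xs. scale c (f xs)) - transfer UNIV K s s' E n f = hochschild_b scale UNIV n' h"
      by auto
    then show ?thesis using hc Suc by auto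
  qed
qed

end

section \<open>The Nakayama automorphism acts trivially on Hochschild cohomology\<close>

text \<open>The cyclic operator of the paracyclic module of \<open>A\<close> twisted by \<open>\<rho>\<close>.\<close>

definition rotate_by :: "('a \<Rightarrow> 'a) \<Rightarrow> 'a list \<Rightarrow> 'a list" where
  "rotate_by \<rho> xs = \<rho> (last xs) # butlast xs"

text \<open>For an index beyond the last adjacent pair this is the wrap-around face.\<close>

definition cyclic_face :: "('a \<Rightarrow> 'a) \<Rightarrow> nat \<Rightarrow> 'a list \<Rightarrow> 'a::{ring, monoid_mult} list" where
  "cyclic_face \<rho> i xs =
     (if Suc i < length xs then take i xs @ (xs ! i * xs ! Suc i) # drop (i + 2) xs
      else (\<rho> (last xs) * hd xs) # tl (butlast xs))"

lemma length_rotate_by [simp]: "xs \<noteq> [] \<Longrightarrow> length (rotate_by \<rho> xs) = length xs"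
  by (simp add: rotate_by_def)

lemma rotate_by_ne [simp]: "rotate_by \<rho> xs \<noteq> []"
  by (simp add: rotate_by_def)

lemma length_rotate_by_funpow [simp]:
  "xs \<noteq> [] \<Longrightarrow> length ((rotate_by \<rho> ^^ j) xs) = length xs"
proof (induction j)
  case (Suc j)
  then have "(rotate_by \<rho> ^^ j) xs \<noteq> []" by (metis length_0_conv)
  then show ?case using Suc by simp
qed simp

lemma length_cyclic_face [simp]:
  "length xs = Suc (Suc n) \<Longrightarrow> length (cyclic_face \<rho> i xs) = Suc n"
  by (auto simp: cyclic_face_def)

text \<open>The generalisation to a list with an unrotated part makes the induction work; for a full turn
  only \<open>\<rho>\<close> remains.\<close>

lemma rotate_by_funpow_partial:
  "length ys = j \<Longrightarrow> (rotate_by \<rho> ^^ j) (xs @ ys) = map \<rho> ys @ xs"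
proof (induction j arbitrary: ys xs)
  case (Suc j)
  then obtain y zs where ys: "ys = y # zs" "length zs = j" by (cases ys) auto
  have "(rotate_by \<rho> ^^ Suc j) (xs @ ys) = rotate_by \<rho> ((rotate_by \<rho> ^^ j) ((xs @ [y]) @ zs))"
    using ys by simp
  also have "\<dots> = map \<rho> ys @ xs"
    using ys Suc.IH[of zs "xs @ [y]"] by (simp only:) (simp add: rotate_by_def butlast_append)
  finally show ?case .
qed simp

lemma rotate_by_funpow_length: "(rotate_by \<rho> ^^ length xs) xs = map \<rho> xs"
  using rotate_by_funpow_partial[of xs "length xs" \<rho> "[]"] by simp

lemma cyclic_face_last:
  assumes "length xs = Suc (Suc n)"
  shows "cyclic_face \<rho> (Suc n) xs = cyclic_face \<rho> 0 (rotate_by \<rho> xs)"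
proof -
  obtain a ys where "xs = a # ys" "length ys = Suc n" using assms by (cases xs) auto
  then show ?thesis
    by (cases ys) (simp_all add: cyclic_face_def rotate_by_def)
qed

lemma cyclic_face_rotate_by:
  assumes mult: "\<And>x y. \<rho> (x * y) = \<rho> x * \<rho> y"
    and xs: "length xs = Suc (Suc n)" and i: "i \<le> n"
  shows "cyclic_face \<rho> (Suc i) (rotate_by \<rho> xs) = rotate_by \<rho> (cyclic_face \<rho> i xs)"
proof (cases "i = n")
  case True
  obtain ys b where ys: "xs = ys @ [b]" "length ys = Suc n" using xs by (cases xs rule: rev_cases) auto
  then obtain zs a where "ys = zs @ [a]" "length zs = n" by (cases ys rule: rev_cases) auto
  with ys have "xs = zs @ [a, b]" "length zs = n" by auto
  then show ?thesis using True mult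
    by (cases zs) (auto simp: cyclic_face_def rotate_by_def butlast_append nth_append)
next
  case False
  define us where "us = take i xs"
  define vs where "vs = drop (i + 2) xs"
  have e: "xs = us @ [xs ! i, xs ! Suc i] @ vs"
    using Cons_nth_drop_Suc[of i xs] Cons_nth_drop_Suc[of "Suc i" xs] append_take_drop_id[of i xs]
      False xs i by (simp add: us_def vs_def)
  have l: "length us = i" "vs \<noteq> []" using False xs i by (auto simp: us_def vs_def)
  obtain a b where e': "xs = us @ [a, b] @ vs" using e by metis
  show ?thesis
    using l by (simp add: e' cyclic_face_def rotate_by_def butlast_append nth_append)
qed

lemma cyclic_face_rotate_by_funpow:
  assumes mult: "\<And>x y. \<rho> (x * y) = \<rho> x * \<rho> y"
    and xs: "length xs = Suc (Suc n)"
  shows "i + j \<le> Suc n \<Longrightarrow>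
    cyclic_face \<rho> (i + j) ((rotate_by \<rho> ^^ j) xs) = (rotate_by \<rho> ^^ j) (cyclic_face \<rho> i xs)"
proof (induction j)
  case (Suc j)
  have "xs \<noteq> []" using xs by auto
  then have "length ((rotate_by \<rho> ^^ j) xs) = Suc (Suc n)" using xs by simp
  from cyclic_face_rotate_by[OF mult this, of "i + j"] show ?case
    using Suc by simp
qed simp

lemma cyclic_face_rotate_by_funpow_wrap:
  assumes mult: "\<And>x y. \<rho> (x * y) = \<rho> x * \<rho> y"
    and xs: "length xs = Suc (Suc n)" and d: "d \<le> n" and that: "i \<le> Suc n"
  shows "cyclic_face \<rho> i ((rotate_by \<rho> ^^ (i + Suc d)) xs) =
    (rotate_by \<rho> ^^ (i + d)) (cyclic_face \<rho> (Suc n - d) xs)"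
proof -
  have ne: "xs \<noteq> []" using xs by auto
  have l: "length ((rotate_by \<rho> ^^ j) xs) = Suc (Suc n)" for j using xs ne by simp
  have "cyclic_face \<rho> i ((rotate_by \<rho> ^^ (i + Suc d)) xs) =
      cyclic_face \<rho> (0 + i) ((rotate_by \<rho> ^^ i) ((rotate_by \<rho> ^^ Suc d) xs))"
    by (simp only: funpow_add o_apply add_0)
  also have "\<dots> = (rotate_by \<rho> ^^ i) (cyclic_face \<rho> 0 ((rotate_by \<rho> ^^ Suc d) xs))"
    using that by (intro cyclic_face_rotate_by_funpow[OF mult l]) auto
  also have "cyclic_face \<rho> 0 ((rotate_by \<rho> ^^ Suc d) xs) =
      cyclic_face \<rho> (Suc n) ((rotate_by \<rho> ^^ d) xs)"
    using cyclic_face_last[OF l[of d]] by simp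
  also have "\<dots> = (rotate_by \<rho> ^^ d) (cyclic_face \<rho> (Suc n - d) xs)"
    using cyclic_face_rotate_by_funpow[OF mult xs, of "Suc n - d" d] d by simp
  finally show ?thesis by (simp add: funpow_add)
qed

text \<open>The relation \<open>b' N = N b\<close> of cyclic homology, where \<open>b'\<close> omits the wrap-around face. A face \<open>i \<ge> j\<close> passes \<open>j\<close> rotations and becomes the face \<open>i - j\<close>, while for
  \<open>i < j\<close> it meets the cut, absorbs one rotation and continues as a face counted from the
  other end. This is a bijection between the index sets that preserves the signs.\<close>

lemma norm_commutes_with_faces:
  fixes G :: "'a::{ring, monoid_mult} list \<Rightarrow> 'k::field"
  assumes mult: "\<And>x y. \<rho> (x * y) = \<rho> x * \<rho> y"
    and xs: "length xs = Suc (Suc n)"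
  shows "(\<Sum>j\<le>Suc n. \<Sum>i\<le>n. (- 1) ^ (Suc n * j) * ((- 1) ^ i * G (cyclic_face \<rho> i ((rotate_by \<rho> ^^ j) xs)))) =
    (\<Sum>i\<le>Suc n. \<Sum>j\<le>n. (- 1) ^ i * ((- 1) ^ (n * j) * G ((rotate_by \<rho> ^^ j) (cyclic_face \<rho> i xs))))"
proof -
  let ?l = "\<lambda>(j, i). (- 1) ^ (Suc n * j) * ((- 1) ^ i * G (cyclic_face \<rho> i ((rotate_by \<rho> ^^ j) xs)))"
  let ?r = "\<lambda>(i, j). (- 1) ^ i * ((- 1) ^ (n * j) * G ((rotate_by \<rho> ^^ j) (cyclic_face \<rho> i xs)))"
  have "sum ?l ({..Suc n} \<times> {..n}) = sum ?r ({..Suc n} \<times> {..n})"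
  proof (rule sum.reindex_bij_witness[where
      i = "\<lambda>(i, j). if i + j \<le> n then (j, i + j) else (Suc j, i + j - Suc n)" and
      j = "\<lambda>(j, i). if j \<le> i then (i - j, j) else (Suc (Suc n) + i - j, j - 1)"])
    fix p assume "p \<in> {..Suc n} \<times> {..n}"
    then obtain j i where p: "p = (j, i)" "j \<le> Suc n" "i \<le> n" by auto
    show "?r (case p of (j, i) \<Rightarrow> if j \<le> i then (i - j, j) else (Suc (Suc n) + i - j, j - 1)) = ?l p"
    proof (cases "j \<le> i")
      case True
      then obtain e where e: "i = e + j" by (metis add.commute le_Suc_ex)
      have s: "(- 1 :: 'k) ^ (j + n * j) * (- 1) ^ (e + j) = (- 1) ^ e * (- 1) ^ (n * j)"
        by (simp add: power_add)
      show ?thesis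
        using cyclic_face_rotate_by_funpow[OF mult xs, of e j] p s
        by (simp add: e mult.assoc[symmetric])
    next
      case False
      then obtain d where d: "j = i + Suc d" by (metis add_Suc_right less_imp_Suc_add not_le)
      then have dn: "d \<le> n" using p by simp
      then obtain e where e: "n = d + e" using le_Suc_ex by blast
      have s: "(- 1 :: 'k) ^ (Suc n * (i + Suc d)) * (- 1) ^ i = (- 1) ^ (Suc n - d) * (- 1) ^ (n * (i + d))"
        unfolding power_add[symmetric] e by (simp add: minus_one_power_iff, blast)
      have "?r (Suc n - d, i + d) = ?l (i + Suc d, i)"
        using cyclic_face_rotate_by_funpow_wrap[OF mult xs dn, of i] p s
        by (simp only: prod.case mult.assoc[symmetric])
      then show ?thesis by (simp add: p d)
    qed
  qed (auto split: if_splits)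
  then show ?thesis by (simp only: sum.cartesian_product)
qed

lemma multilinear_on_rotate_by:
  fixes \<rho> :: "'a \<Rightarrow> 'a::ab_group_add"
  assumes "multilinear_on scl sclb UNIV n G"
    and "\<And>x y. \<rho> (x + y) = \<rho> x + \<rho> y" "\<And>c x. \<rho> (scl c x) = scl c (\<rho> x)"
  shows "multilinear_on scl sclb UNIV n (\<lambda>xs. G (rotate_by \<rho> xs))"
proof -
  have upd: "rotate_by \<rho> (xs[i := x]) =
      (if Suc i = length xs then (rotate_by \<rho> xs)[0 := \<rho> x] else (rotate_by \<rho> xs)[Suc i := x])"
    if i: "i < length xs" for xs i x
  proof -
    obtain ys y where "xs = ys @ [y]" using i by (cases xs rule: rev_cases) auto
    then show ?thesis using i by (auto simp: rotate_by_def list_update_append)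
  qed
  have len: "length (rotate_by \<rho> xs) = n" if "length xs = n" "i < n" for xs i
    using that by (auto simp: rotate_by_def)
  have G_add: "G (xs[i := x + y]) = G (xs[i := x]) + G (xs[i := y])"
    if "length xs = n" "i < n" for xs i x y
    using assms(1) that by (simp add: multilinear_on_def)
  have G_scl: "G (xs[i := scl c x]) = sclb c (G (xs[i := x]))"
    if "length xs = n" "i < n" for xs i c x
    using assms(1) that by (simp add: multilinear_on_def)
  show ?thesis
    unfolding multilinear_on_def
  proof (intro conjI ballI allI impI)
    fix xs :: "'a list" and i x y assume a: "xs \<in> tuples UNIV n" "i < n"
    then show "G (rotate_by \<rho> (xs[i := x + y])) =
        G (rotate_by \<rho> (xs[i := x])) + G (rotate_by \<rho> (xs[i := y]))"
      using G_add[OF len[of xs i], of 0] G_add[OF len[of xs i], of "Suc i"]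
      by (simp add: upd assms(2))
  next
    fix xs :: "'a list" and i c x assume a: "xs \<in> tuples UNIV n" "i < n"
    then show "G (rotate_by \<rho> (xs[i := scl c x])) = sclb c (G (rotate_by \<rho> (xs[i := x])))"
      using G_scl[OF len[of xs i], of 0] G_scl[OF len[of xs i], of "Suc i"]
      by (simp add: upd assms(3))
  qed
qed

locale nakayama_algebra = algebra_over_field scale
  for scale :: "'k::field \<Rightarrow> 'a::{ring, monoid_mult} \<Rightarrow> 'a" +
  fixes \<phi> :: "'a \<Rightarrow> 'k" and \<rho> :: "'a \<Rightarrow> 'a"
  assumes frobenius: "frobenius_hom scale \<phi>"
    and nakayama: "nakayama_automorphism scale \<phi> \<rho>"
begin

lemma vector_space_field: "vector_space ((*) :: 'k \<Rightarrow> 'k \<Rightarrow> 'k)"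
  by unfold_locales (simp_all add: algebra_simps)

lemma dual_iff: "L \<in> dual scale \<longleftrightarrow> (\<forall>x y. L (x + y) = L x + L y) \<and> (\<forall>c x. L (scale c x) = c * L x)"
  using vector_space_field vector_space_axioms
  by (auto simp: dual_def Vector_Spaces.linear_iff)

lemma \<phi>_add: "\<phi> (x + y) = \<phi> x + \<phi> y" and \<phi>_scale: "\<phi> (scale c x) = c * \<phi> x"
  using frobenius by (auto simp: frobenius_hom_def dual_iff)

lemma \<phi>_diff: "\<phi> (x - y) = \<phi> x - \<phi> y"
  using \<phi>_add[of "x - y" y] by simp

lemma \<phi>_0: "\<phi> 0 = 0"
  using \<phi>_diff[of 0 0] by simp

lemma \<phi>_sum: "\<phi> (\<Sum>l\<in>L. g l) = (\<Sum>l\<in>L. \<phi> (g l))"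
  by (induction L rule: infinite_finite_induct) (simp_all add: \<phi>_add \<phi>_0)

lemma \<phi>_separates: "(\<And>a. \<phi> (a * x) = \<phi> (a * y)) \<Longrightarrow> x = y"
  using frobenius by (auto simp: frobenius_hom_def bij_betw_def inj_on_def dual_lact_def)

lemma \<phi>_represents:
  assumes "\<And>x y. L (x + y) = L x + L y" "\<And>c x. L (scale c x) = c * L x"
  shows "\<exists>x. \<forall>a. \<phi> (a * x) = L a"
proof -
  have "L \<in> (\<lambda>x. dual_lact x \<phi>) ` UNIV"
    using frobenius assms by (auto simp: frobenius_hom_def bij_betw_def dual_iff)
  then show ?thesis by (auto simp: dual_lact_def)
qed

lemma \<rho>_add: "\<rho> (x + y) = \<rho> x + \<rho> y" and \<rho>_scale: "\<rho> (scale c x) = scale c (\<rho> x)"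
  and \<rho>_mult: "\<rho> (x * y) = \<rho> x * \<rho> y" and \<rho>_1: "\<rho> 1 = 1" and bij_\<rho>: "bij \<rho>"
  using nakayama by (auto simp: nakayama_automorphism_def algebra_automorphism_def Vector_Spaces.linear_iff)

lemma \<phi>_twist: "\<phi> (a * x) = \<phi> (\<rho> x * a)"
  using nakayama by (auto simp: nakayama_automorphism_def dual_lact_def dual_ract_def fun_eq_iff)

lemma \<phi>_\<rho>: "\<phi> (\<rho> x) = \<phi> x"
  using \<phi>_twist[of 1 x] by simp

text \<open>Since \<open>\<phi>\<close> is nondegenerate, cochains of degree \<open>n\<close> are the same as forms in \<open>n + 1\<close> arguments, and
  only on the latter is the rotation defined.\<close>

definition form :: "('a list \<Rightarrow> 'a) \<Rightarrow> 'a list \<Rightarrow> 'k" where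
  "form f xs = \<phi> (hd xs * f (tl xs))"

text \<open>Here \<open>n\<close> is one less than the length of the lists. On lists of length \<open>n + 1\<close> this is the norm
  \<open>1 + t + \<dots> + t\<^sup>n\<close> for the rotation \<open>t\<close> with the sign \<open>(-1)\<^sup>n\<close>.\<close>

definition cyclic_norm :: "nat \<Rightarrow> ('a list \<Rightarrow> 'k) \<Rightarrow> 'a list \<Rightarrow> 'k" where
  "cyclic_norm n G xs = (\<Sum>j\<le>n. (- 1) ^ (n * j) * G ((rotate_by \<rho> ^^ j) xs))"

text \<open>Apply \<open>\<phi>\<close> to the cocycle condition. By \<open>\<phi>(a x) = \<phi>(\<rho>(x) a)\<close> the last summand
  \<open>f(x\<^sub>0, \<dots>, x\<^sub>n) x\<^bsub>n+1\<^esub>\<close> becomes the form of \<open>f\<close> on the rotated list, so that the form changes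
  under one rotation by merged terms only.\<close>

lemma form_cocycle:
  assumes f: "f \<in> hochschild_cocycles scale UNIV (Suc n)" and xs: "length xs = Suc (Suc n)"
  shows "(\<Sum>i\<le>n. (- 1) ^ i * \<phi> (f (cyclic_face \<rho> i xs))) =
    form f xs - (- 1) ^ Suc n * form f (rotate_by \<rho> xs)"
proof -
  obtain x us where x: "xs = x # us" using xs by (cases xs) auto
  have "hd xs * f (tl xs) = tail_coboundary f xs"
    using f hochschild_b_Cons[of x UNIV us "Suc n" f] xs x
    by (simp add: hochschild_cocycles_def)
  then have "form f xs = \<phi> (tail_coboundary f xs)" by (simp add: form_def)
  also have "\<dots> = (\<Sum>i\<le>n. (- 1) ^ i * \<phi> (f (cyclic_face \<rho> i xs))) +
      (- 1) ^ Suc n * \<phi> (f (butlast xs) * last xs)"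
    unfolding tail_coboundary_eq_sum[OF xs] \<phi>_add \<phi>_sum \<phi>_scale
    using xs unfolding lessThan_Suc_atMost by (simp add: cyclic_face_def)
  also have "\<phi> (f (butlast xs) * last xs) = form f (rotate_by \<rho> xs)"
    by (simp add: form_def rotate_by_def \<phi>_twist[of _ "last xs"])
  finally show ?thesis by simp
qed

text \<open>Under the identification with forms, the Hochschild coboundary is the alternating sum of all
  cyclic faces, including the wrap-around one.\<close>

lemma form_coboundary:
  assumes xs: "length xs = Suc (Suc n)"
  shows "form (hochschild_b scale UNIV n u) xs = (\<Sum>i\<le>Suc n. (- 1) ^ i * form u (cyclic_face \<rho> i xs))"
proof -
  obtain x y zs where x: "xs = x # y # zs" "length zs = n"
    using xs by (metis length_Suc_conv)
  have l: "length (y # zs) = Suc n" using x by simp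
  have face: "x * u (take i (y # zs) @ ((y # zs) ! i * (y # zs) ! Suc i) # drop (i + 2) (y # zs)) =
      hd (cyclic_face \<rho> (Suc i) xs) * u (tl (cyclic_face \<rho> (Suc i) xs))" if "i < n" for i
    using that x by (simp add: cyclic_face_def)
  have last: "\<phi> (x * (u (butlast (y # zs)) * last (y # zs))) = form u (cyclic_face \<rho> (Suc n) xs)"
    using x \<phi>_twist[of "x * u (butlast (y # zs))" "last (y # zs)"]
    by (simp add: form_def cyclic_face_def mult.assoc)
  have "form (hochschild_b scale UNIV n u) xs = \<phi> (x * (y * u zs)) - \<phi> (x * tail_coboundary u (y # zs))"
    using hochschild_b_Cons[of y UNIV zs n u] x by (simp add: form_def right_diff_distrib \<phi>_diff)
  also have "\<phi> (x * (y * u zs)) = form u (cyclic_face \<rho> 0 xs)"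
    using x by (simp add: form_def cyclic_face_def mult.assoc)
  also have "\<phi> (x * tail_coboundary u (y # zs)) =
      (\<Sum>i<n. (- 1) ^ i * form u (cyclic_face \<rho> (Suc i) xs)) + (- 1) ^ n * form u (cyclic_face \<rho> (Suc n) xs)"
    unfolding tail_coboundary_eq_sum[OF l] distrib_left \<phi>_add sum_distrib_left \<phi>_sum scale_mult_right \<phi>_scale last
    by (simp add: form_def face[simplified])
  also have "form u (cyclic_face \<rho> 0 xs) - \<dots> = (\<Sum>i\<le>Suc n. (- 1) ^ i * form u (cyclic_face \<rho> i xs))"
    unfolding lessThan_Suc_atMost[symmetric]
    by (subst sum.lessThan_Suc_shift) (simp add: sum_negf)
  finally show ?thesis .
qed

text \<open>Add the relations of the previous lemmas for all the rotations of a list. The differences telescope to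
  the difference between the list and its full turn.\<close>

lemma cyclic_norm_telescope:
  assumes f: "f \<in> hochschild_cocycles scale UNIV (Suc n)" and xs: "length xs = Suc (Suc n)"
  shows "(\<Sum>i\<le>Suc n. (- 1) ^ i * cyclic_norm n (\<lambda>us. \<phi> (f us)) (cyclic_face \<rho> i xs)) =
    form f xs - form f (map \<rho> xs)"
proof -
  have ne: "xs \<noteq> []" using xs by auto
  let ?F = "\<lambda>j. (- 1) ^ (Suc n * j) * form f ((rotate_by \<rho> ^^ j) xs)"
  have "(\<Sum>i\<le>Suc n. (- 1) ^ i * cyclic_norm n (\<lambda>us. \<phi> (f us)) (cyclic_face \<rho> i xs)) =
      (\<Sum>j\<le>Suc n. \<Sum>i\<le>n. (- 1) ^ (Suc n * j) *
        ((- 1) ^ i * \<phi> (f (cyclic_face \<rho> i ((rotate_by \<rho> ^^ j) xs)))))"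
    unfolding cyclic_norm_def sum_distrib_left
    by (rule norm_commutes_with_faces[OF \<rho>_mult xs, where G = "\<lambda>us. \<phi> (f us)", symmetric])
  also have "\<dots> = (\<Sum>j\<le>Suc n. ?F j - ?F (Suc j))"
  proof (rule sum.cong[OF refl])
    fix j
    have "length ((rotate_by \<rho> ^^ j) xs) = Suc (Suc n)" using xs ne by simp
    from form_cocycle[OF f this]
    show "(\<Sum>i\<le>n. (- 1) ^ (Suc n * j) * ((- 1) ^ i * \<phi> (f (cyclic_face \<rho> i ((rotate_by \<rho> ^^ j) xs))))) =
        ?F j - ?F (Suc j)"
      unfolding sum_distrib_left[symmetric]
      by (simp add: right_diff_distrib distrib_left power_add mult_ac)
  qed
  also have "\<dots> = ?F 0 - ?F (Suc (Suc n))"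
    by (rule sum_telescope)
  also have "(- 1 :: 'k) ^ (Suc n * Suc (Suc n)) = 1"
    by (simp add: minus_one_power_iff)
  then have "?F (Suc (Suc n)) = form f (map \<rho> xs)"
    using rotate_by_funpow_length[of xs \<rho>, unfolded xs] by simp
  finally show ?thesis by simp
qed

text \<open>As \<open>\<phi>\<close> is invariant under \<open>\<rho>\<close>, the form of this cochain is the form of \<open>f\<close> with \<open>\<rho>\<close>
  applied to all arguments.\<close>

definition pullback :: "('a list \<Rightarrow> 'a) \<Rightarrow> 'a list \<Rightarrow> 'a" where
  "pullback f xs = inv \<rho> (f (map \<rho> xs))"

lemma inv_\<rho>_0: "inv \<rho> 0 = 0"
proof -
  have "\<rho> 0 = 0" using \<rho>_add[of 0 0] by simp
  then show ?thesis using inv_f_f[OF bij_is_inj[OF bij_\<rho>], of 0] by simp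
qed

lemma \<rho>_pullback: "\<rho> (pullback f xs) = f (map \<rho> xs)"
  using bij_\<rho> by (simp add: pullback_def bij_is_surj surj_f_inv_f)

lemma form_map: "form f (map \<rho> xs) = form (pullback f) xs" if "xs \<noteq> []"
proof -
  have "form f (map \<rho> xs) = \<phi> (\<rho> (hd xs * pullback f (tl xs)))"
    using that by (simp add: form_def \<rho>_mult \<rho>_pullback hd_map map_tl)
  then show ?thesis by (simp add: \<phi>_\<rho> form_def)
qed

lemma ex_cochain_of_form:
  assumes G: "multilinear_on scale (*) UNIV (Suc n) G"
  shows "\<exists>u\<in>hochschild_cochains scale UNIV n. \<forall>xs. length xs = Suc n \<longrightarrow> form u xs = G xs"
proof -
  note G' = G[unfolded multilinear_on_Suc]
  have "\<exists>y. \<forall>a. \<phi> (a * y) = G (a # xs)" if "length xs = n" for xs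
    by (rule \<phi>_represents) (use G' that in simp_all)
  then have "\<forall>xs. \<exists>y. length xs = n \<longrightarrow> (\<forall>a. \<phi> (a * y) = G (a # xs))"
    by blast
  from choice[OF this] obtain v where v: "\<phi> (a * v xs) = G (a # xs)" if "length xs = n" for xs a
    by blast
  have G1: "multilinear_on scale (*) UNIV n (\<lambda>us. G (a # us))" for a using G' by auto
  have "multilinear_on scale scale UNIV n v"
    unfolding multilinear_on_def
  proof (intro conjI ballI allI impI; rule \<phi>_separates)
    fix xs :: "'a list" and i x y a assume "xs \<in> tuples UNIV n" "i < n"
    then show "\<phi> (a * v (xs[i := x + y])) = \<phi> (a * (v (xs[i := x]) + v (xs[i := y])))"
      using G1[of a] by (simp add: v distrib_left \<phi>_add multilinear_on_def)
  next
    fix xs :: "'a list" and i c x a assume "xs \<in> tuples UNIV n" "i < n"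
    then show "\<phi> (a * v (xs[i := scale c x])) = \<phi> (a * scale c (v (xs[i := x])))"
      using G1[of a] by (simp add: v scale_mult_right \<phi>_scale multilinear_on_def)
  qed
  then have "multilinear_on scale scale UNIV n (\<lambda>xs. if xs \<in> tuples UNIV n then v xs else 0)"
    by (rule multilinear_on_restrict) (rule subspace_UNIV)
  moreover have "form (\<lambda>xs. if xs \<in> tuples UNIV n then v xs else 0) xs = G xs"
    if "length xs = Suc n" for xs
    using that v by (cases xs) (simp_all add: form_def)
  ultimately show ?thesis
    by (intro bexI[of _ "\<lambda>xs. if xs \<in> tuples UNIV n then v xs else 0"] allI impI)
      (simp_all add: hochschild_cochains_iff)
qed

lemma multilinear_on_cyclic_norm:
  assumes "multilinear_on scale (*) UNIV m G"
  shows "multilinear_on scale (*) UNIV m (cyclic_norm n G)"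
proof -
  have "multilinear_on scale (*) UNIV m (\<lambda>xs. G ((rotate_by \<rho> ^^ j) xs))" for j
  proof (induction j)
    case (Suc j)
    from multilinear_on_rotate_by[OF this \<rho>_add \<rho>_scale] show ?case
      by (simp add: funpow_swap1)
  qed (use assms in simp)
  then have
    "\<And>j xs i x y. length xs = m \<Longrightarrow> i < m \<Longrightarrow> G ((rotate_by \<rho> ^^ j) (xs[i := x + y])) =
      G ((rotate_by \<rho> ^^ j) (xs[i := x])) + G ((rotate_by \<rho> ^^ j) (xs[i := y]))"
    "\<And>j xs i c x. length xs = m \<Longrightarrow> i < m \<Longrightarrow> G ((rotate_by \<rho> ^^ j) (xs[i := scale c x])) =
      c * G ((rotate_by \<rho> ^^ j) (xs[i := x]))"
    by (simp_all add: multilinear_on_def)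
  then show ?thesis
    unfolding multilinear_on_def cyclic_norm_def
    by (simp add: sum.distrib sum_distrib_left distrib_left mult.left_commute)
qed

text \<open>The homotopy sends \<open>f\<close> to the cochain whose form is the norm of \<open>\<phi> \<circ> f\<close>. In terms of the form of
  \<open>f\<close>, this inserts a unit in front of every rotation of the arguments. In degree \<open>0\<close>
  the statement is that \<open>\<rho>\<close> fixes the centre.\<close>

theorem pullback_homotopic_id:
  assumes f: "f \<in> hochschild_cocycles scale UNIV n"
  shows "f - pullback f \<in> hochschild_coboundaries scale UNIV n"
proof (cases n)
  case 0
  have c: "f [] * x = x * f []" for x
    using f hochschild_b_Cons[of x UNIV "[]" 0 f] 0 by (simp add: hochschild_cocycles_def)
  have "\<rho> (f []) = f []"
  proof (rule \<phi>_separates)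
    fix b
    obtain a where b: "b = \<rho> a" using bij_\<rho> by (metis bij_is_surj surjD)
    have "\<phi> (b * \<rho> (f [])) = \<phi> (a * f [])" by (simp add: b \<rho>_mult[symmetric] \<phi>_\<rho>)
    also have "\<dots> = \<phi> (f [] * a)" by (simp add: c)
    also have "\<dots> = \<phi> (b * f [])" by (simp only: b \<phi>_twist[of "f []" a])
    finally show "\<phi> (b * \<rho> (f [])) = \<phi> (b * f [])" .
  qed
  then have nil: "pullback f [] = f []"
    using inv_f_f[OF bij_is_inj[OF bij_\<rho>], of "f []"] by (simp add: pullback_def)
  have out: "f (x # xs) = 0" for x xs
    using f 0 by (simp add: hochschild_cocycles_def hochschild_cochains_iff)
  have "f - pullback f = 0"
  proof
    fix xs
    show "(f - pullback f) xs = 0 xs"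
      by (cases xs) (simp_all add: nil, simp add: out pullback_def inv_\<rho>_0)
  qed
  then show ?thesis using 0 by simp
next
  case (Suc n')
  have fc: "f \<in> hochschild_cochains scale UNIV n" using f by (simp add: hochschild_cocycles_def)
  have "multilinear_on scale (*) UNIV n (\<lambda>us. \<phi> (f us))"
    using fc by (simp add: hochschild_cochains_iff multilinear_on_def \<phi>_add \<phi>_scale)
  from ex_cochain_of_form[OF multilinear_on_cyclic_norm[OF this[unfolded Suc]]]
  obtain u where u: "u \<in> hochschild_cochains scale UNIV n'"
    and form_u: "\<And>xs. length xs = Suc n' \<Longrightarrow> form u xs = cyclic_norm n' (\<lambda>us. \<phi> (f us)) xs"
    by metis
  have "hochschild_b scale UNIV n' u us = (f - pullback f) us" for us
  proof (cases "length us = n")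
    case True
    show ?thesis
    proof (rule \<phi>_separates)
      fix a
      have l: "length (a # us) = Suc (Suc n')" using True Suc by simp
      have "form (hochschild_b scale UNIV n' u) (a # us) =
          (\<Sum>i\<le>Suc n'. (- 1) ^ i * cyclic_norm n' (\<lambda>us. \<phi> (f us)) (cyclic_face \<rho> i (a # us)))"
        unfolding form_coboundary[OF l] using l by (intro sum.cong refl) (simp add: form_u)
      also have "\<dots> = form f (a # us) - form (pullback f) (a # us)"
        using cyclic_norm_telescope[OF f[unfolded Suc] l] form_map[of "a # us" f] by simp
      finally show "\<phi> (a * hochschild_b scale UNIV n' u us) = \<phi> (a * (f - pullback f) us)"
        by (simp add: form_def right_diff_distrib \<phi>_diff)
    qed
  next
    case False
    then show ?thesis
      using fc Suc by (simp add: hochschild_b_outside hochschild_cochains_iff pullback_def inv_\<rho>_0)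
  qed
  then have "f - pullback f = hochschild_b scale UNIV n' u" by auto
  then show ?thesis using u Suc by auto
qed

end

section \<open>Cochain maps and induced maps in cohomology\<close>

lemma sum_fun_apply: "(\<Sum>l\<in>L. f l) x = (\<Sum>l\<in>L. f l x)"
  by (induction L rule: infinite_finite_induct) simp_all

context algebra_over_field
begin

abbreviation "smul c f \<equiv> (\<lambda>xs. scale c (f xs))"

abbreviation "cochains \<equiv> hochschild_cochains scale"
abbreviation "cocycles \<equiv> hochschild_cocycles scale"
abbreviation "coboundaries \<equiv> hochschild_coboundaries scale"

lemma cochains_add: "subspace S \<Longrightarrow> f \<in> cochains S n \<Longrightarrow> g \<in> cochains S n \<Longrightarrow> f + g \<in> cochains S n"
  by (auto simp: hochschild_cochains_iff multilinear_on_def subspace_add scale_right_distrib)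

lemma cochains_smul: "subspace S \<Longrightarrow> f \<in> cochains S n \<Longrightarrow> smul c f \<in> cochains S n"
  by (auto simp: hochschild_cochains_iff multilinear_on_def subspace_scale scale_right_distrib
      scale_left_commute)

lemma cochains_0: "subspace S \<Longrightarrow> 0 \<in> cochains S n"
  by (auto simp: hochschild_cochains_iff multilinear_on_def subspace_0)

lemma hochschild_b_0: "hochschild_b scale S n 0 = 0"
  using hochschild_b_add[of S n 0 0] by simp

lemma coboundaries_0: "subspace S \<Longrightarrow> 0 \<in> coboundaries S n"
  using hochschild_b_0 cochains_0 by (cases n) (auto intro!: image_eqI[of _ _ 0])

lemma coboundaries_add:
  "subspace S \<Longrightarrow> f \<in> coboundaries S n \<Longrightarrow> g \<in> coboundaries S n \<Longrightarrow> f + g \<in> coboundaries S n"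
  using cochains_add by (cases n) (auto simp: hochschild_b_add[symmetric])

lemma coboundaries_smul:
  "subspace S \<Longrightarrow> f \<in> coboundaries S n \<Longrightarrow> smul c f \<in> coboundaries S n"
  using cochains_smul
  by (cases n) (auto simp: hochschild_b_scale[symmetric] zero_fun_def)

lemma coboundaries_uminus: "subspace S \<Longrightarrow> f \<in> coboundaries S n \<Longrightarrow> - f \<in> coboundaries S n"
  using coboundaries_smul[of S f n "- 1"] by (simp add: fun_Compl_def)

lemma coboundaries_diff:
  "subspace S \<Longrightarrow> f \<in> coboundaries S n \<Longrightarrow> g \<in> coboundaries S n \<Longrightarrow> f - g \<in> coboundaries S n"
  using coboundaries_add[of S f n "- g"] coboundaries_uminus[of S g n] by simp

lemma coboundaries_sum:
  "subspace S \<Longrightarrow> (\<And>l. l \<in> L \<Longrightarrow> f l \<in> coboundaries S n) \<Longrightarrow> (\<Sum>l\<in>L. f l) \<in> coboundaries S n"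
  by (induction L rule: infinite_finite_induct) (simp_all add: coboundaries_0 coboundaries_add)

lemma cocycles_add: "subspace S \<Longrightarrow> f \<in> cocycles S n \<Longrightarrow> g \<in> cocycles S n \<Longrightarrow> f + g \<in> cocycles S n"
  by (simp add: hochschild_cocycles_def cochains_add hochschild_b_add)

lemma cocycles_smul: "subspace S \<Longrightarrow> f \<in> cocycles S n \<Longrightarrow> smul c f \<in> cocycles S n"
  by (simp add: hochschild_cocycles_def cochains_smul hochschild_b_scale zero_fun_def)

lemma cocycles_diff: "subspace S \<Longrightarrow> f \<in> cocycles S n \<Longrightarrow> g \<in> cocycles S n \<Longrightarrow> f - g \<in> cocycles S n"
proof -
  assume S: "subspace S" and f: "f \<in> cocycles S n" and g: "g \<in> cocycles S n"
  have "smul (- 1) g = - g" by (simp add: fun_Compl_def)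
  then have "- g \<in> cocycles S n" using cocycles_smul[OF S g, of "- 1"] by simp
  then show ?thesis using cocycles_add[OF S f] by (metis diff_conv_add_uminus)
qed

lemma cocycles_sum:
  "subspace S \<Longrightarrow> (\<And>l. l \<in> L \<Longrightarrow> f l \<in> cocycles S n) \<Longrightarrow> (\<Sum>l\<in>L. f l) \<in> cocycles S n"
  by (induction L rule: infinite_finite_induct)
    (simp_all add: cocycles_add, simp_all add: hochschild_cocycles_def cochains_0 hochschild_b_0)

lemma coset_eq_iff:
  assumes "subspace S"
  shows "f +o coboundaries S n = g +o coboundaries S n \<longleftrightarrow> f - g \<in> coboundaries S n"
proof
  assume "f +o coboundaries S n = g +o coboundaries S n"
  then have "f + 0 \<in> g +o coboundaries S n"
    using set_plus_intro2[OF coboundaries_0[OF assms]] by metis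
  then show "f - g \<in> coboundaries S n" by (auto simp: elt_set_plus_def)
next
  assume d: "f - g \<in> coboundaries S n"
  have "a +o coboundaries S n \<subseteq> b +o coboundaries S n" if "a - b \<in> coboundaries S n" for a b
  proof
    fix x assume "x \<in> a +o coboundaries S n"
    then obtain u where u: "u \<in> coboundaries S n" "x = a + u" by (auto simp: elt_set_plus_def)
    have "b + ((a - b) + u) \<in> b +o coboundaries S n"
      by (intro set_plus_intro2 coboundaries_add[OF assms that u(1)])
    also have "b + ((a - b) + u) = x" by (simp add: u(2) algebra_simps)
    finally show "x \<in> b +o coboundaries S n" .
  qed
  from this[OF d] this[of g f] coboundaries_uminus[OF assms d]
  show "f +o coboundaries S n = g +o coboundaries S n" by auto
qed

text \<open>The map induced on cosets, for both scalar multiples and cochain maps: adding the coboundaries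
  of the target completes the image of a coset to a coset.\<close>

lemma coset_image:
  fixes f :: "'a list \<Rightarrow> 'a"
  assumes "subspace T" "0 \<in> U"
    and "\<And>u. u \<in> U \<Longrightarrow> F u \<in> coboundaries T n" "\<And>u. F (f + u) = F f + F u"
  shows "F ` (f +o U) + coboundaries T n = F f +o coboundaries T n"
proof (intro equalityI subsetI)
  fix x assume "x \<in> F ` (f +o U) + coboundaries T n"
  then obtain u v where "u \<in> U" "v \<in> coboundaries T n" "x = F (f + u) + v"
    by (auto simp: elt_set_plus_def set_plus_def)
  then have "x = F f + (F u + v)" "F u + v \<in> coboundaries T n"
    using assms coboundaries_add by (auto simp: add.assoc)
  then show "x \<in> F f +o coboundaries T n" by (auto simp: elt_set_plus_def)
next
  fix x assume "x \<in> F f +o coboundaries T n"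
  then obtain v where v: "v \<in> coboundaries T n" "x = F f + v" by (auto simp: elt_set_plus_def)
  have "f \<in> f +o U" using set_plus_intro2[OF assms(2), of f] by simp
  then show "x \<in> F ` (f +o U) + coboundaries T n"
    using v by (auto simp: set_plus_def)
qed

lemma HH_scale_coset:
  assumes "subspace S"
  shows "HH_scale scale S n c (f +o coboundaries S n) = smul c f +o coboundaries S n"
  unfolding HH_scale_def
  by (rule coset_image)
    (use assms coboundaries_0 coboundaries_smul in \<open>auto simp: scale_right_distrib fun_eq_iff\<close>)

lemma coset_add:
  assumes "subspace S"
  shows "(f +o coboundaries S n) + (g +o coboundaries S n) = (f + g) +o coboundaries S n"
proof (intro equalityI subsetI)
  fix x assume "x \<in> (f +o coboundaries S n) + (g +o coboundaries S n)"
  then obtain u v where "u \<in> coboundaries S n" "v \<in> coboundaries S n" "x = (f + u) + (g + v)"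
    by (auto simp: elt_set_plus_def set_plus_def)
  then have "x = (f + g) + (u + v)" "u + v \<in> coboundaries S n"
    using coboundaries_add[OF assms] by (auto simp: algebra_simps)
  then show "x \<in> (f + g) +o coboundaries S n" by (auto simp: elt_set_plus_def)
next
  fix x assume "x \<in> (f + g) +o coboundaries S n"
  then obtain u where u: "u \<in> coboundaries S n" "x = (f + u) + (g + 0)"
    by (auto simp: elt_set_plus_def algebra_simps)
  then show "x \<in> (f +o coboundaries S n) + (g +o coboundaries S n)"
    unfolding u(2) using coboundaries_0[OF assms]
    by (intro set_plus_intro set_plus_intro2)
qed

text \<open>Additivity on all functions, not just on cochains, lets such maps act on whole cosets without
  side conditions.\<close>

definition cochain_map :: "'a set \<Rightarrow> 'a set \<Rightarrow> (nat \<Rightarrow> ('a list \<Rightarrow> 'a) \<Rightarrow> ('a list \<Rightarrow> 'a)) \<Rightarrow> bool" where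
  "cochain_map S T F \<longleftrightarrow>
     (\<forall>n. \<forall>f\<in>cochains S n. F n f \<in> cochains T n \<and>
        hochschild_b scale T n (F n f) = F (Suc n) (hochschild_b scale S n f)) \<and>
     (\<forall>n f g. F n (f + g) = F n f + F n g)"

lemma cochain_map_cocycles:
  assumes "cochain_map S T F" "f \<in> cocycles S n"
  shows "F n f \<in> cocycles T n"
proof -
  have "F (Suc n) (0 + 0) = F (Suc n) 0 + F (Suc n) 0"
    using assms(1) unfolding cochain_map_def by blast
  then have "F (Suc n) 0 = 0" by simp
  then show ?thesis using assms by (simp add: cochain_map_def hochschild_cocycles_def)
qed

lemma cochain_map_coboundaries:
  assumes "cochain_map S T F" "f \<in> coboundaries S n"
  shows "F n f \<in> coboundaries T n"
proof -
  have "F n (0 + 0) = F n 0 + F n 0"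
    using assms(1) unfolding cochain_map_def by blast
  then have F0: "F n 0 = 0" by simp
  show ?thesis
  proof (cases n)
    case 0
    then show ?thesis using assms(2) F0 by simp
  next
    case (Suc n')
    then obtain u where u: "u \<in> cochains S n'" "f = hochschild_b scale S n' u" using assms(2) by auto
    have "F n' u \<in> cochains T n'" "hochschild_b scale T n' (F n' u) = F n f"
      using assms(1) u(1) unfolding cochain_map_def u(2) Suc by blast+
    then show ?thesis unfolding Suc by (metis hochschild_coboundaries.simps(2) image_eqI)
  qed
qed

lemma cochain_map_diff:
  assumes "cochain_map S T F"
  shows "F n (f - g) = F n f - F n g"
proof -
  have "F n ((f - g) + g) = F n (f - g) + F n g"
    using assms unfolding cochain_map_def by blast
  then show ?thesis by simp
qed

lemma HH_induced_coset:
  assumes "cochain_map S T F" "subspace S" "subspace T"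
  shows "HH_induced scale T n (F n) (f +o coboundaries S n) = F n f +o coboundaries T n"
  unfolding HH_induced_def
  using assms(1) coboundaries_0[OF assms(2)] cochain_map_coboundaries[OF assms(1)]
  by (intro coset_image[OF assms(3)]) (auto simp: cochain_map_def)

end

lemma (in matrix_map) cochain_map_transfer:
  assumes "\<And>n f xs. f \<in> cochains S n \<Longrightarrow> xs \<in> tuples T n \<Longrightarrow> transfer T K s s' E n f xs \<in> T"
  shows "cochain_map S T (transfer T K s s' E)"
  unfolding cochain_map_def
  using assms transfer_in_cochains transfer_chain_map transfer_add
  by (auto simp: hochschild_cochains_iff)

section \<open>The action in terms of transfers\<close>

lemma sum_tuples_Suc:
  "(\<Sum>js\<in>tuples K (Suc n). g js) = (\<Sum>\<kappa>\<in>K. \<Sum>js\<in>tuples K n. g (\<kappa> # js))"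
proof -
  have "tuples K (Suc n) = (\<lambda>(\<kappa>, js). \<kappa> # js) ` (K \<times> tuples K n)"
    by (auto simp: tuples_Suc)
  moreover have "inj_on (\<lambda>(\<kappa>, js). \<kappa> # js) (K \<times> tuples K n)" by (auto simp: inj_on_def)
  ultimately show ?thesis
    by (simp add: sum.reindex sum.cartesian_product split_def)
qed

lemma path_sum_eq_sum_tuples:
  "path_sum K s E f \<kappa> xs = (\<Sum>js\<in>tuples K (length xs).
     f (map (\<lambda>l. E ((\<kappa> # js) ! l) ((\<kappa> # js) ! Suc l) (xs ! l)) [0..<length xs])
     * s ((\<kappa> # js) ! length xs))"
proof (induction xs arbitrary: f \<kappa>)
  case (Cons x xs)
  show ?case
    unfolding path_sum.simps Cons.IH list.size(4) add_0_right add_Suc_right sum_tuples_Suc map_upt_Suc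
    by simp
qed simp

text \<open>So the cochain maps that define the action are transfers. Unfolding the recursion turns the sum over
  paths into the sum over lists of indices.\<close>

lemma transfer_eq_hochschild_theta:
  "transfer S K s s' (\<lambda>\<kappa> \<mu> x. s \<kappa> * x * s' \<mu>) n f = hochschild_theta S K s s' n f"
proof
  fix xs
  show "transfer S K s s' (\<lambda>\<kappa> \<mu> x. s \<kappa> * x * s' \<mu>) n f xs = hochschild_theta S K s s' n f xs"
    unfolding transfer_def hochschild_theta_def path_sum_eq_sum_tuples sum_tuples_Suc
    by (auto simp: tuples_def sum_distrib_left mult.assoc)
qed

lemma (in algebra_over_field) matrix_map_conj:
  assumes "subspace T" "subspace S"
    and "\<And>x y. x \<in> T \<Longrightarrow> y \<in> T \<Longrightarrow> x * y \<in> T" "\<And>x y. x \<in> S \<Longrightarrow> y \<in> S \<Longrightarrow> x * y \<in> S"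
    and "\<And>\<kappa> \<mu> x. \<kappa> \<in> K \<Longrightarrow> \<mu> \<in> K \<Longrightarrow> x \<in> T \<Longrightarrow> s \<kappa> * x * s' \<mu> \<in> S"
    and one: "(\<Sum>\<kappa>\<in>K. s' \<kappa> * s \<kappa>) = 1"
  shows "matrix_map scale T S K s s' (\<lambda>\<kappa> \<mu> x. s \<kappa> * x * s' \<mu>)"
proof
  have one': "(\<Sum>\<kappa>\<in>K. s' \<kappa> * (s \<kappa> * y)) = y" for y
    using one by (simp add: mult.assoc[symmetric] sum_distrib_right[symmetric])
  show "(\<Sum>\<kappa>\<in>K. s' \<kappa> * (s \<kappa> * x * s' \<mu>)) = x * s' \<mu>" for x \<mu>
    using one'[of "x * s' \<mu>"] by (simp add: mult.assoc)
  show "(\<Sum>\<mu>\<in>K. s \<kappa> * x * s' \<mu> * s \<mu>) = s \<kappa> * x" for x \<kappa>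
    using one by (simp add: mult.assoc sum_distrib_left[symmetric])
  show "(\<Sum>\<mu>\<in>K. s \<kappa> * x * s' \<mu> * (s \<mu> * y * s' \<nu>)) = s \<kappa> * (x * y) * s' \<nu>" for x y \<kappa> \<nu>
    using one'[of "y * s' \<nu>"] by (simp add: mult.assoc sum_distrib_left[symmetric])
qed (use assms in \<open>simp_all add: distrib_left distrib_right scale_mult_left scale_mult_right\<close>)

section \<open>The grading and its degree-zero projection\<close>

text \<open>The powers of \<open>w\<close> other than \<open>1\<close> are roots of \<open>1 + x + \<dots> + x\<^bsup>m-1\<^esup>\<close>. If \<open>m\<close> were
  zero in the field, then \<open>1\<close> would be a root as well, giving \<open>m\<close> distinct roots of a polynomial of
  degree below \<open>m\<close>.\<close>

lemma primitive_root_imp_of_nat_nonzero: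
  assumes "primitive_root_of_unity m (w :: 'k::field)"
  shows "(of_nat m :: 'k) \<noteq> 0"
proof
  assume 0: "(of_nat m :: 'k) = 0"
  have prim: "w ^ r \<noteq> 1" if "1 \<le> r" "r < m" for r
    using assms that by (auto simp: primitive_root_of_unity_def)
  have m: "1 \<le> m" "w ^ m = 1" using assms by (auto simp: primitive_root_of_unity_def)
  have w: "w \<noteq> 0" using m by (metis power_0_left zero_neq_one not_one_le_zero)
  define q :: "'k poly" where "q = (\<Sum>i<m. monom 1 i)"
  have poly_q: "poly q x = (\<Sum>i<m. x ^ i)" for x
    by (simp add: q_def poly_sum poly_monom)
  have "coeff q 0 = 1" using m by (simp add: q_def coeff_sum)
  then have q0: "q \<noteq> 0" by auto
  have deg: "degree q \<le> m - 1"
    unfolding q_def by (intro degree_sum_le) (auto intro: order.trans[OF degree_monom_le])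
  have root: "poly q (w ^ r) = 0" if "r < m" for r
  proof (cases "r = 0")
    case True
    then show ?thesis using 0 by (simp add: poly_q)
  next
    case False
    then have "w ^ r \<noteq> 1" using prim that by simp
    moreover have "(w ^ r) ^ m = 1" using m by (metis power_mult mult.commute power_one)
    ultimately show ?thesis using geometric_sum[of "w ^ r" m] by (simp add: poly_q)
  qed
  have "inj_on (\<lambda>r. w ^ r) {..<m}"
  proof (rule linorder_inj_onI)
    fix a b assume ab: "a < b" "a \<in> {..<m}" "b \<in> {..<m}"
    show "w ^ a \<noteq> w ^ b"
    proof
      assume "w ^ a = w ^ b"
      also have "w ^ b = w ^ a * w ^ (b - a)" using ab by (simp add: power_add[symmetric])
      finally have "w ^ (b - a) = 1" using w by simp
      then show False using prim[of "b - a"] ab by (simp add: Suc_le_eq less_imp_diff_less)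
    qed
  qed auto
  then have "m = card ((\<lambda>r. w ^ r) ` {..<m})" by (simp add: card_image)
  also have "\<dots> \<le> card {x. poly q x = 0}"
    using root by (intro card_mono poly_roots_finite q0) auto
  also have "\<dots> \<le> degree q" by (rule card_poly_roots_bound[OF q0])
  finally show False using deg m by simp
qed

locale nakayama_graded = nakayama_algebra scale \<phi> \<rho>
  for scale :: "'k::field \<Rightarrow> 'a::{ring, monoid_mult} \<Rightarrow> 'a" and \<phi> :: "'a \<Rightarrow> 'k" and \<rho> :: "'a \<Rightarrow> 'a" +
  fixes m :: nat and w :: 'k
    and J :: "nat \<Rightarrow> 'j set" and s s' :: "nat \<Rightarrow> 'j \<Rightarrow> 'a"
  assumes order: "has_order \<rho> m"
    and root: "primitive_root_of_unity m w"
    and families: "action_families m (eigencomponent scale \<rho> w) J s s'"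
begin

abbreviation "A \<equiv> eigencomponent scale \<rho> w"
abbreviation "B \<equiv> eigencomponent scale \<rho> w 0"

lemma m_pos: "0 < m" and w_m: "w ^ m = 1" and w_prim: "1 \<le> r \<Longrightarrow> r < m \<Longrightarrow> w ^ r \<noteq> 1"
  using root by (auto simp: primitive_root_of_unity_def)

lemma m_nonzero: "(of_nat m :: 'k) \<noteq> 0"
  by (rule primitive_root_imp_of_nat_nonzero[OF root])

lemma \<rho>_m: "\<rho> ^^ m = id"
  using order by (simp add: has_order_def)

lemma finite_J: "i < m \<Longrightarrow> finite (J i)"
  and s_in: "i < m \<Longrightarrow> j \<in> J i \<Longrightarrow> s i j \<in> A i"
  and s'_in: "i < m \<Longrightarrow> j \<in> J i \<Longrightarrow> s' i j \<in> A (m - i)"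
  and sum_s's: "i < m \<Longrightarrow> (\<Sum>j\<in>J i. s' i j * s i j) = 1"
  using families by (auto simp: action_families_def)

lemma A_iff: "a \<in> A i \<longleftrightarrow> \<rho> a = scale (w ^ i) a"
  by (simp add: eigencomponent_def)

lemma B_iff: "a \<in> B \<longleftrightarrow> \<rho> a = a"
  by (simp add: A_iff)

lemma A_mult: "a \<in> A i \<Longrightarrow> b \<in> A j \<Longrightarrow> a * b \<in> A (i + j)"
  by (simp add: A_iff \<rho>_mult scale_mult_left scale_mult_right power_add mult.commute)

lemma A_m: "A m = B"
  by (simp add: eigencomponent_def w_m)

lemma \<rho>_0: "\<rho> 0 = 0"
  using \<rho>_add[of 0 0] by simp

lemma subspace_B: "subspace B"
  by (rule subspaceI) (simp_all add: B_iff \<rho>_0 \<rho>_add \<rho>_scale)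

lemma B_mult: "x \<in> B \<Longrightarrow> y \<in> B \<Longrightarrow> x * y \<in> B"
  by (simp add: B_iff \<rho>_mult)

lemma \<rho>_funpow_add: "(\<rho> ^^ r) (x + y) = (\<rho> ^^ r) x + (\<rho> ^^ r) y"
  by (induction r) (simp_all add: \<rho>_add)

lemma \<rho>_funpow_scale: "(\<rho> ^^ r) (scale c x) = scale c ((\<rho> ^^ r) x)"
  by (induction r) (simp_all add: \<rho>_scale)

lemma \<rho>_funpow_mult: "(\<rho> ^^ r) (x * y) = (\<rho> ^^ r) x * (\<rho> ^^ r) y"
  by (induction r) (simp_all add: \<rho>_mult)

lemma \<rho>_funpow_A: "a \<in> A i \<Longrightarrow> (\<rho> ^^ r) a = scale ((w ^ i) ^ r) a"
  by (induction r) (simp_all add: A_iff \<rho>_scale mult.commute)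

definition proj :: "'a \<Rightarrow> 'a" where
  "proj x = scale (inverse (of_nat m)) (\<Sum>r<m. (\<rho> ^^ r) x)"

lemma proj_add: "proj (x + y) = proj x + proj y"
  by (simp add: proj_def \<rho>_funpow_add sum.distrib scale_right_distrib)

lemma proj_scale: "proj (scale c x) = scale c (proj x)"
  by (simp add: proj_def \<rho>_funpow_scale scale_sum_right[symmetric] mult.commute)

lemma proj_0: "proj 0 = 0"
  using proj_add[of 0 0] by simp

lemma proj_diff: "proj (x - y) = proj x - proj y"
  using proj_add[of "x - y" y] by simp

lemma proj_sum: "proj (\<Sum>l\<in>L. g l) = (\<Sum>l\<in>L. proj (g l))"
  by (induction L rule: infinite_finite_induct) (simp_all add: proj_0 proj_add)

lemma sum_orbit_\<rho>: "(\<Sum>r<m. (\<rho> ^^ Suc r) x) = (\<Sum>r<m. (\<rho> ^^ r) x)"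
proof -
  have "(\<Sum>r<Suc m. (\<rho> ^^ r) x) = x + (\<Sum>r<m. (\<rho> ^^ Suc r) x)"
    by (subst sum.lessThan_Suc_shift) simp
  moreover have "(\<Sum>r<Suc m. (\<rho> ^^ r) x) = (\<Sum>r<m. (\<rho> ^^ r) x) + x"
    by (simp add: \<rho>_m)
  ultimately show ?thesis by (simp add: add.commute)
qed

lemma \<rho>_sum: "\<rho> (\<Sum>l\<in>L. g l) = (\<Sum>l\<in>L. \<rho> (g l))"
  by (induction L rule: infinite_finite_induct) (simp_all add: \<rho>_0 \<rho>_add)

lemma proj_in_B: "proj x \<in> B"
  using sum_orbit_\<rho>[of x] by (simp add: B_iff proj_def \<rho>_scale \<rho>_sum)

lemma proj_\<rho>: "proj (\<rho> x) = proj x"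
  using sum_orbit_\<rho>[of x] by (simp add: proj_def funpow_swap1)

text \<open>Multiplying by elements of opposite degrees preserves the degree. With \<open>i = j = 0\<close> this says that
  the projection is linear over the degree-zero part.\<close>

lemma proj_mult_A:
  assumes "a \<in> A i" "b \<in> A j" "i + j = m \<or> i + j = 0"
  shows "proj (a * x * b) = a * proj x * b"
proof -
  have 1: "w ^ i * w ^ j = 1" using assms(3) w_m by (auto simp: power_add[symmetric])
  have "(w ^ i) ^ r * (w ^ j) ^ r = 1" for r
    using 1 by (simp add: power_mult_distrib[symmetric])
  then have "(\<rho> ^^ r) (a * x * b) = a * (\<rho> ^^ r) x * b" for r
    using assms by (simp add: \<rho>_funpow_mult \<rho>_funpow_A scale_mult_left scale_mult_right mult.commute[of "(w ^ j) ^ r"])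
  then show ?thesis
    by (simp add: proj_def sum_distrib_left sum_distrib_right scale_mult_left scale_mult_right)
qed

lemma one_in_B: "1 \<in> B" by (simp add: B_iff \<rho>_1)

lemma proj_mult_left: "b \<in> B \<Longrightarrow> proj (b * x) = b * proj x"
  and proj_mult_right: "b \<in> B \<Longrightarrow> proj (x * b) = proj x * b"
  using proj_mult_A[of b 0 1 0 x] proj_mult_A[of 1 0 b 0 x] one_in_B by simp_all

lemma proj_B: "x \<in> B \<Longrightarrow> proj x = x"
  using \<rho>_funpow_A[of x 0] m_nonzero
  by (simp add: proj_def sum_constant_scale)

lemma proj_A_nonzero: "a \<in> A i \<Longrightarrow> w ^ i \<noteq> 1 \<Longrightarrow> proj a = 0"
  using proj_\<rho>[of a] scale_cancel_right[of "w ^ i" "proj a" 1] by (simp add: A_iff proj_scale)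

lemma sum_root_powers: "r < m \<Longrightarrow> (\<Sum>i<m. (w ^ (m - i)) ^ r) = (if r = 0 then of_nat m else 0)"
  and sum_root_powers': "r < m \<Longrightarrow> (\<Sum>i<m. (w ^ i) ^ r) = (if r = 0 then of_nat m else 0)"
proof -
  assume r: "r < m"
  have sw: "(w ^ i) ^ r = (w ^ r) ^ i" for i by (simp add: power_mult[symmetric] mult.commute)
  show 1: "(\<Sum>i<m. (w ^ i) ^ r) = (if r = 0 then of_nat m else 0)"
    using r w_prim[of r] geometric_sum[of "w ^ r" m] w_m by (simp add: sw sw[of m, symmetric])
  have "(\<Sum>i<m. (w ^ (m - i)) ^ r) = (\<Sum>i<m. (w ^ Suc i) ^ r)"
    by (rule sum.reindex_bij_witness[of _ "\<lambda>i. m - Suc i" "\<lambda>i. m - Suc i"])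
      (auto simp: Suc_diff_Suc simp del: power_Suc)
  also have "\<dots> = w ^ r * (\<Sum>i<m. (w ^ i) ^ r)"
    by (simp add: power_mult_distrib sum_distrib_left)
  finally show "(\<Sum>i<m. (w ^ (m - i)) ^ r) = (if r = 0 then of_nat m else 0)"
    by (simp add: 1)
qed

text \<open>The union over all degrees is what makes every homogeneous component reachable: the elements of
  one degree alone would expand only that component.\<close>

definition K :: "(nat \<times> 'j) set" where "K = Sigma {..<m} J"

abbreviation sK :: "nat \<times> 'j \<Rightarrow> 'a" where "sK \<kappa> \<equiv> s (fst \<kappa>) (snd \<kappa>)"
abbreviation sK' :: "nat \<times> 'j \<Rightarrow> 'a" where "sK' \<kappa> \<equiv> s' (fst \<kappa>) (snd \<kappa>)"

lemma sum_K: "(\<Sum>\<kappa>\<in>K. g \<kappa>) = (\<Sum>i<m. \<Sum>j\<in>J i. g (i, j))"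
  unfolding K_def by (subst sum.Sigma) (auto simp: finite_J)

text \<open>Orthogonality of characters, in the form in which it recombines the homogeneous
  components of \<open>x\<close>.\<close>

lemma scale_sum_orthogonal:
  assumes "\<And>r. r < m \<Longrightarrow> (\<Sum>i<m. c i r) = (if r = 0 then of_nat m else 0)"
  shows "(\<Sum>i<m. scale (inverse (of_nat m)) (\<Sum>r<m. scale (c i r) ((\<rho> ^^ r) x))) = x"
proof -
  have "(\<Sum>i<m. \<Sum>r<m. scale (c i r) ((\<rho> ^^ r) x)) = (\<Sum>r<m. if r = 0 then scale (of_nat m) x else 0)"
    by (subst sum.swap) (intro sum.cong refl, simp add: scale_sum_left[symmetric] assms)
  also have "\<dots> = scale (of_nat m) x" using m_pos by (simp add: sum.delta)
  finally show ?thesis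
    using m_nonzero by (simp add: scale_sum_right[symmetric])
qed

text \<open>For a fixed degree \<open>i\<close> the sum over \<open>J i\<close> is the homogeneous component of \<open>x\<close> in degree \<open>i\<close>: the
  projection sees \<open>s'\<close> only through powers of \<open>w\<close>, and then \<open>\<Sum> s' s = 1\<close>.\<close>

lemma expand_right: "(\<Sum>\<mu>\<in>K. proj (x * sK' \<mu>) * sK \<mu>) = x"
proof -
  have "(\<Sum>j\<in>J i. proj (x * s' i j) * s i j) =
      scale (inverse (of_nat m)) (\<Sum>r<m. scale ((w ^ (m - i)) ^ r) ((\<rho> ^^ r) x))" if i: "i < m" for i
  proof -
    have "proj (x * s' i j) * s i j =
        scale (inverse (of_nat m)) (\<Sum>r<m. scale ((w ^ (m - i)) ^ r) ((\<rho> ^^ r) x)) * (s' i j * s i j)"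
      if "j \<in> J i" for j
      using \<rho>_funpow_A[OF s'_in[OF i that]]
      by (simp add: proj_def \<rho>_funpow_mult sum_distrib_right scale_mult_left scale_mult_right mult.assoc)
    then show ?thesis
      using sum_s's[OF i] by (simp add: sum_distrib_left[symmetric])
  qed
  then show ?thesis
    using scale_sum_orthogonal[OF sum_root_powers] by (simp add: sum_K)
qed

lemma expand_left: "(\<Sum>\<kappa>\<in>K. sK' \<kappa> * proj (sK \<kappa> * x)) = x"
proof -
  have "(\<Sum>j\<in>J i. s' i j * proj (s i j * x)) =
      scale (inverse (of_nat m)) (\<Sum>r<m. scale ((w ^ i) ^ r) ((\<rho> ^^ r) x))" if i: "i < m" for i
  proof -
    have "s' i j * proj (s i j * x) = (s' i j * s i j) *
        scale (inverse (of_nat m)) (\<Sum>r<m. scale ((w ^ i) ^ r) ((\<rho> ^^ r) x))"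
      if "j \<in> J i" for j
      using \<rho>_funpow_A[OF s_in[OF i that]]
      by (simp add: proj_def \<rho>_funpow_mult sum_distrib_left scale_mult_left scale_mult_right mult.assoc)
    then show ?thesis
      using sum_s's[OF i] by (simp add: sum_distrib_right[symmetric])
  qed
  then show ?thesis
    using scale_sum_orthogonal[OF sum_root_powers'] by (simp add: sum_K)
qed

definition E :: "nat \<times> 'j \<Rightarrow> nat \<times> 'j \<Rightarrow> 'a \<Rightarrow> 'a" where
  "E \<kappa> \<mu> x = proj (sK \<kappa> * x * sK' \<mu>)"

text \<open>Multiplicativity follows by expanding the product in the middle; moving the projection across a
  factor is allowed because that factor is already of degree zero.\<close>

lemma matrix_map_E:
  assumes "subspace S" "\<And>x y. x \<in> S \<Longrightarrow> y \<in> S \<Longrightarrow> x * y \<in> S" "B \<subseteq> S"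
  shows "matrix_map scale UNIV S K sK sK' E"
proof
  show "(\<Sum>\<kappa>\<in>K. sK' \<kappa> * E \<kappa> \<mu> x) = x * sK' \<mu>" for \<mu> x
    using expand_left[of "x * sK' \<mu>"] by (simp add: E_def mult.assoc)
  show "(\<Sum>\<mu>\<in>K. E \<kappa> \<mu> x * sK \<mu>) = sK \<kappa> * x" for \<kappa> x
    using expand_right[of "sK \<kappa> * x"] by (simp add: E_def)
  show "(\<Sum>\<mu>\<in>K. E \<kappa> \<mu> x * E \<mu> \<nu> y) = E \<kappa> \<nu> (x * y)" for \<kappa> \<nu> x y
  proof -
    have "(\<Sum>\<mu>\<in>K. E \<kappa> \<mu> x * E \<mu> \<nu> y) = (\<Sum>\<mu>\<in>K. proj (E \<kappa> \<mu> x * sK \<mu> * (y * sK' \<nu>)))"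
      by (intro sum.cong refl) (simp add: E_def proj_mult_left[OF proj_in_B, symmetric] mult.assoc)
    also have "\<dots> = proj ((\<Sum>\<mu>\<in>K. E \<kappa> \<mu> x * sK \<mu>) * (y * sK' \<nu>))"
      by (simp only: proj_sum sum_distrib_right)
    also have "\<dots> = E \<kappa> \<nu> (x * y)"
      using expand_right[of "sK \<kappa> * x"] by (simp add: E_def mult.assoc)
    finally show ?thesis .
  qed
  show "E \<kappa> \<mu> x \<in> S" for \<kappa> \<mu> x
    using assms(3) proj_in_B by (auto simp: E_def)
qed (use assms subspace_UNIV in \<open>simp_all add: E_def proj_add proj_scale distrib_left distrib_right
    scale_mult_left scale_mult_right\<close>)

end

section \<open>Restriction to degree zero and its transfer\<close>

context nakayama_graded
begin

definition restrict :: "nat \<Rightarrow> ('a list \<Rightarrow> 'a) \<Rightarrow> ('a list \<Rightarrow> 'a)" where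
  "restrict n f = (\<lambda>xs. if xs \<in> tuples B n then proj (f xs) else 0)"

lemma proj_tail_coboundary:
  "xs \<in> tuples B n \<Longrightarrow> proj (tail_coboundary f xs) = tail_coboundary (\<lambda>us. proj (f us)) xs"
proof (induction f xs arbitrary: n rule: tail_coboundary.induct)
  case (2 f x)
  then show ?case by (auto simp: tuples_def proj_mult_right)
next
  case (3 f x y zs)
  have "y # zs \<in> tuples B (Suc (length zs))" using "3.prems" by (auto simp: tuples_def)
  from "3.IH"[OF this] show ?case by (simp add: proj_diff)
qed (simp add: proj_0)

lemma cochain_map_restrict: "cochain_map UNIV B restrict"
  unfolding cochain_map_def
proof (intro conjI allI ballI)
  fix n and f :: "'a list \<Rightarrow> 'a" assume f: "f \<in> cochains UNIV n"
  have "multilinear_on scale scale B n f"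
    using f multilinear_on_mono[OF _ subset_UNIV] by (auto simp: hochschild_cochains_iff)
  then have "multilinear_on scale scale B n (\<lambda>xs. proj (f xs))"
    by (simp add: multilinear_on_def proj_add proj_scale)
  from multilinear_on_restrict[OF this subspace_B]
  show "restrict n f \<in> cochains B n"
    by (simp add: hochschild_cochains_iff restrict_def proj_in_B)
  show "hochschild_b scale B n (restrict n f) = restrict (Suc n) (hochschild_b scale UNIV n f)"
  proof
    fix xs
    show "hochschild_b scale B n (restrict n f) xs = restrict (Suc n) (hochschild_b scale UNIV n f) xs"
    proof (cases "xs \<in> tuples B (Suc n)")
      case True
      then obtain x us where xs: "xs = x # us" "x \<in> B" "us \<in> tuples B n" by (auto simp: tuples_Suc)
      have "length us = n" using xs by (simp add: tuples_def)
      then have "restrict (Suc n) (hochschild_b scale UNIV n f) xs =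
          x * proj (f us) - tail_coboundary (\<lambda>us. proj (f us)) xs"
        using xs True hochschild_b_Cons[of x UNIV us n f] proj_tail_coboundary[OF True, of f]
        by (simp add: restrict_def proj_diff proj_mult_left)
      also have "tail_coboundary (\<lambda>us. proj (f us)) xs = tail_coboundary (restrict n f) xs"
        by (rule tail_coboundary_cong[OF B_mult True]) (simp_all add: restrict_def)
      finally show ?thesis using xs by (simp add: hochschild_b_Cons restrict_def)
    qed (simp add: hochschild_b_outside restrict_def)
  qed
next
  fix n and f g :: "'a list \<Rightarrow> 'a"
  show "restrict n (f + g) = restrict n f + restrict n g"
    by (auto simp: restrict_def proj_add)
qed

lemma restrict_smul: "restrict n (smul c f) = smul c (restrict n f)"
  by (auto simp: restrict_def proj_scale)

abbreviation "theta i \<equiv> hochschild_theta B (J i) (s i) (s' i)"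

lemma s_x_s'_in_B:
  assumes "i < m" "j \<in> J i" "j' \<in> J i" "x \<in> B"
  shows "s i j * x * s' i j' \<in> B" "s' i j * x * s i j' \<in> B"
proof -
  have "i + 0 + (m - i) = m" "(m - i) + 0 + i = m" using assms(1) by simp_all
  then show "s i j * x * s' i j' \<in> B" "s' i j * x * s i j' \<in> B"
    using A_mult[OF A_mult[OF s_in[OF assms(1,2)] assms(4)] s'_in[OF assms(1,3)]]
      A_mult[OF A_mult[OF s'_in[OF assms(1,2)] assms(4)] s_in[OF assms(1,3)]] A_m
    by simp_all
qed

lemma cochain_map_theta: "cochain_map B B (theta i)" if i: "i < m"
proof -
  interpret matrix_map scale B B "J i" "s i" "s' i" "\<lambda>\<kappa> \<mu> x. s i \<kappa> * x * s' i \<mu>"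
    using i sum_s's subspace_B B_mult s_x_s'_in_B by (intro matrix_map_conj) auto
  have "hochschild_theta B (J i) (s i) (s' i) n f xs \<in> B"
    if f: "f \<in> cochains B n" and xs: "xs \<in> tuples B n" for n f xs
  proof -
    have "s' i (js ! 0) * f (map (\<lambda>l. s i (js ! l) * xs ! l * s' i (js ! Suc l)) [0..<n]) * s i (js ! n) \<in> B"
      if js: "js \<in> tuples (J i) (Suc n)" for js
    proof (rule s_x_s'_in_B(2)[OF i])
      have nth: "js ! l \<in> J i" if "l \<le> n" for l using js that by (auto simp: tuples_def)
      then show "js ! 0 \<in> J i" "js ! n \<in> J i" by auto
      have "map (\<lambda>l. s i (js ! l) * xs ! l * s' i (js ! Suc l)) [0..<n] \<in> tuples B n"
        using xs nth by (auto simp: tuples_def intro!: s_x_s'_in_B(1)[OF i])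
      then show "f (map (\<lambda>l. s i (js ! l) * xs ! l * s' i (js ! Suc l)) [0..<n]) \<in> B"
        using f by (auto simp: hochschild_cochains_iff)
    qed
    then show ?thesis
      using xs by (auto simp: hochschild_theta_def intro!: subspace_sum[OF subspace_B])
  qed
  then show ?thesis
    using cochain_map_transfer unfolding transfer_eq_hochschild_theta by blast
qed

text \<open>The defining formula of the action makes sense over the whole algebra too, where it is homotopic to
  the identity because \<open>\<Sum> s' s = 1\<close>. It commutes with the restriction.\<close>

lemma restrict_theta:
  assumes i: "i < m" and f: "f \<in> cocycles UNIV n"
  shows "theta i n (restrict n f) - restrict n f \<in> coboundaries B n"
proof -
  interpret matrix_map scale UNIV UNIV "J i" "s i" "s' i" "\<lambda>\<kappa> \<mu> x. s i \<kappa> * x * s' i \<mu>"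
    using i sum_s's by (intro matrix_map_conj) (auto simp: subspace_UNIV)
  let ?f' = "hochschild_theta UNIV (J i) (s i) (s' i) n f"
  have "f - ?f' \<in> coboundaries UNIV n"
    using transfer_homotopic_multiple[OF refl refl, of 1] f sum_s's[OF i]
    unfolding transfer_eq_hochschild_theta by simp
  then have "restrict n (f - ?f') \<in> coboundaries B n"
    by (rule cochain_map_coboundaries[OF cochain_map_restrict])
  then have "restrict n ?f' - restrict n f \<in> coboundaries B n"
    using coboundaries_uminus[OF subspace_B] unfolding cochain_map_diff[OF cochain_map_restrict]
    by fastforce
  moreover have "restrict n ?f' = theta i n (restrict n f)"
  proof
    fix xs
    show "restrict n ?f' xs = theta i n (restrict n f) xs"
    proof (cases "xs \<in> tuples B n")
      case True
      have "proj (s' i (js ! 0) * f (map (\<lambda>l. s i (js ! l) * xs ! l * s' i (js ! Suc l)) [0..<n]) * s i (js ! n))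
          = s' i (js ! 0) * restrict n f (map (\<lambda>l. s i (js ! l) * xs ! l * s' i (js ! Suc l)) [0..<n]) * s i (js ! n)"
        if js: "js \<in> tuples (J i) (Suc n)" for js
      proof -
        have nth: "js ! l \<in> J i" if "l \<le> n" for l using js that by (auto simp: tuples_def)
        have "map (\<lambda>l. s i (js ! l) * xs ! l * s' i (js ! Suc l)) [0..<n] \<in> tuples B n"
          using True nth by (auto simp: tuples_def intro!: s_x_s'_in_B(1)[OF i])
        moreover have "m - i + i = m" using i by simp
        ultimately show ?thesis
          using proj_mult_A[OF s'_in[OF i nth[of 0]] s_in[OF i nth[of n]]]
          by (simp add: restrict_def)
      qed
      moreover have "length xs = n" using True by (simp add: tuples_def)
      ultimately show ?thesis
        using True by (simp add: restrict_def hochschild_theta_def proj_sum)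
    qed (simp add: restrict_def hochschild_theta_def)
  qed
  ultimately show ?thesis by simp
qed

abbreviation "extend \<equiv> transfer UNIV K sK sK' E"

lemma matrix_map_B: "matrix_map scale UNIV B K sK sK' E"
  using matrix_map_E[OF subspace_B B_mult] by simp

lemma matrix_map_UNIV: "matrix_map scale UNIV UNIV K sK sK' E"
  using matrix_map_E[OF subspace_UNIV] by simp

lemma cochain_map_extend: "cochain_map B UNIV extend"
  by (rule matrix_map.cochain_map_transfer[OF matrix_map_B]) simp

lemma w_mixed_power: "w ^ (i + (m - i')) \<noteq> 1" if "i < m" "i' < m" "i \<noteq> i'"
proof (cases "i' < i")
  case True
  then have "i + (m - i') = m + (i - i')" using that by simp
  then have "w ^ (i + (m - i')) = w ^ (i - i')" by (simp only: power_add w_m mult_1)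
  then show ?thesis using w_prim[of "i - i'"] True that by simp
next
  case False
  then show ?thesis using w_prim[of "i + (m - i')"] that by simp
qed

text \<open>For \<open>x\<close> of degree zero, \<open>s x s'\<close> is homogeneous, and it has degree zero exactly if both indices
  have the same degree. Hence only paths that stay in one \<open>J i\<close> contribute.\<close>

lemma path_sum_E_on_B:
  assumes i: "i < m"
  shows "multilinear_on scale scale B n f \<Longrightarrow> j \<in> J i \<Longrightarrow> xs \<in> tuples B n \<Longrightarrow>
    path_sum K sK E f (i, j) xs = path_sum (J i) (s i) (\<lambda>\<kappa> \<mu> x. s i \<kappa> * x * s' i \<mu>) f j xs"
proof (induction n arbitrary: f j xs)
  case 0
  then show ?case by simp
next
  case (Suc n)
  obtain x us where xs: "xs = x # us" "x \<in> B" "us \<in> tuples B n"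
    using Suc.prems by (auto simp: tuples_Suc)
  note f = Suc.prems(1)[unfolded multilinear_on_Suc]
  have f0: "f (0 # vs) = 0" if "vs \<in> tuples B n" for vs
  proof -
    have "f (scale 0 x # vs) = scale 0 (f (x # vs))" using f xs(2) that by blast
    then show ?thesis by simp
  qed
  have off: "path_sum K sK E (\<lambda>us. f (E (i, j) (i', j') x # us)) (i', j') us = 0"
    if "i' < m" "j' \<in> J i'" "i' \<noteq> i" for i' j'
  proof -
    have "s i j * x * s' i' j' \<in> A (i + 0 + (m - i'))"
      using A_mult[OF A_mult[OF s_in[OF i Suc.prems(2)] xs(2)] s'_in[OF that(1,2)]] .
    then have "E (i, j) (i', j') x = 0"
      using proj_A_nonzero w_mixed_power[of i i'] i that by (simp add: E_def)
    then have "path_sum K sK E (\<lambda>us. f (E (i, j) (i', j') x # us)) (i', j') us =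
        path_sum K sK E (\<lambda>us. 0) (i', j') us"
      using that xs f0 matrix_map.E_in[OF matrix_map_B]
      by (intro path_sum_cong[of K UNIV E B us n]) (auto simp: K_def tuples_def)
    then show ?thesis by (simp add: path_sum_zero)
  qed
  have diag: "path_sum K sK E (\<lambda>us. f (E (i, j) (i, j') x # us)) (i, j') us =
      path_sum (J i) (s i) (\<lambda>\<kappa> \<mu> x. s i \<kappa> * x * s' i \<mu>) (\<lambda>us. f (s i j * x * s' i j' # us)) j' us"
    if "j' \<in> J i" for j'
  proof -
    have "s i j * x * s' i j' \<in> B" using s_x_s'_in_B(1)[OF i Suc.prems(2) that xs(2)] .
    moreover from this have "E (i, j) (i, j') x = s i j * x * s' i j'" by (simp add: E_def proj_B)
    ultimately show ?thesis using f that xs by (simp add: Suc.IH)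
  qed
  have "path_sum K sK E f (i, j) xs =
      (\<Sum>i'<m. \<Sum>j'\<in>J i'. path_sum K sK E (\<lambda>us. f (E (i, j) (i', j') x # us)) (i', j') us)"
    by (simp add: xs sum_K)
  also have "\<dots> = (\<Sum>i'<m. if i' = i then
      (\<Sum>j'\<in>J i. path_sum K sK E (\<lambda>us. f (E (i, j) (i, j') x # us)) (i, j') us) else 0)"
    by (intro sum.cong refl) (auto simp: off intro!: sum.neutral)
  also have "\<dots> = (\<Sum>j'\<in>J i. path_sum K sK E (\<lambda>us. f (E (i, j) (i, j') x # us)) (i, j') us)"
    using i by (simp add: sum.delta)
  finally show ?case by (simp add: xs diag)
qed

lemma restrict_extend:
  assumes f: "f \<in> cochains B n"
  shows "restrict n (extend n f) = (\<Sum>i<m. theta i n f)"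
proof
  fix xs
  have ml: "multilinear_on scale scale B n f" using f by (simp add: hochschild_cochains_iff)
  show "restrict n (extend n f) xs = (\<Sum>i<m. theta i n f) xs"
  proof (cases "xs \<in> tuples B n")
    case True
    have "extend n f xs = (\<Sum>i<m. theta i n f xs)"
      using True path_sum_E_on_B[OF _ ml _ True]
      unfolding transfer_eq_hochschild_theta[symmetric]
      by (auto simp: transfer_def sum_K tuples_def)
    moreover have "theta i n f xs \<in> B" if "i < m" for i
      using cochain_map_theta[OF that] f True by (auto simp: cochain_map_def hochschild_cochains_iff)
    ultimately show ?thesis
      using True by (simp add: restrict_def sum_fun_apply proj_sum proj_B)
  next
    case False
    then show ?thesis by (simp add: restrict_def sum_fun_apply hochschild_theta_def)
  qed
qed

section \<open>Averaging over the Nakayama automorphism\<close>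

text \<open>The inverse of the pullback. Its powers are the ones that occur in the projection when restricted to
  degree zero.\<close>

definition pushforward :: "nat \<Rightarrow> ('a list \<Rightarrow> 'a) \<Rightarrow> ('a list \<Rightarrow> 'a)" where
  "pushforward n f xs = \<rho> (f (map (inv \<rho>) xs))"

lemma \<rho>_inv_\<rho>: "\<rho> (inv \<rho> x) = x" and inv_\<rho>_\<rho>: "inv \<rho> (\<rho> x) = x"
  using bij_\<rho> by (simp_all add: bij_is_surj surj_f_inv_f bij_is_inj)

lemma inv_\<rho>_add: "inv \<rho> (x + y) = inv \<rho> x + inv \<rho> y"
  by (metis \<rho>_add \<rho>_inv_\<rho> inv_\<rho>_\<rho>)

lemma inv_\<rho>_mult: "inv \<rho> (x * y) = inv \<rho> x * inv \<rho> y"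
  by (metis \<rho>_mult \<rho>_inv_\<rho> inv_\<rho>_\<rho>)

lemma inv_\<rho>_scale: "inv \<rho> (scale c x) = scale c (inv \<rho> x)"
  by (metis \<rho>_scale \<rho>_inv_\<rho> inv_\<rho>_\<rho>)

lemma \<rho>_diff: "\<rho> (x - y) = \<rho> x - \<rho> y"
  using \<rho>_add[of "x - y" y] by simp

lemma tail_coboundary_pushforward:
  "tail_coboundary (pushforward n f) xs = \<rho> (tail_coboundary f (map (inv \<rho>) xs))"
proof (induction xs arbitrary: f rule: induct_list012)
  case (3 x y zs)
  have "(\<lambda>us. pushforward n f (x # us)) = pushforward n (\<lambda>us. f (inv \<rho> x # us))"
    by (simp add: pushforward_def fun_eq_iff)
  then have "tail_coboundary (\<lambda>us. pushforward n f (x # us)) (y # zs) =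
      \<rho> (tail_coboundary (\<lambda>us. f (inv \<rho> x # us)) (map (inv \<rho>) (y # zs)))"
    using "3.IH"(2) by simp
  then show ?case by (simp add: \<rho>_diff pushforward_def inv_\<rho>_mult)
qed (simp_all add: \<rho>_0 \<rho>_mult \<rho>_inv_\<rho> pushforward_def)

lemma cochain_map_pushforward: "cochain_map UNIV UNIV pushforward"
  unfolding cochain_map_def
proof (intro conjI allI ballI)
  fix n and f :: "'a list \<Rightarrow> 'a" assume f: "f \<in> cochains UNIV n"
  show "pushforward n f \<in> cochains UNIV n"
    using f by (simp add: hochschild_cochains_iff multilinear_on_def pushforward_def map_update
        inv_\<rho>_add inv_\<rho>_scale \<rho>_add \<rho>_scale \<rho>_0)
  show "hochschild_b scale UNIV n (pushforward n f) = pushforward (Suc n) (hochschild_b scale UNIV n f)"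
  proof
    fix xs
    show "hochschild_b scale UNIV n (pushforward n f) xs =
        pushforward (Suc n) (hochschild_b scale UNIV n f) xs"
    proof (cases "length xs = Suc n")
      case True
      then obtain x us where xs: "xs = x # us" "length us = n" by (cases xs) auto
      show ?thesis
        using xs hochschild_b_Cons[of x UNIV us n "pushforward n f"]
          hochschild_b_Cons[of "inv \<rho> x" UNIV "map (inv \<rho>) us" n f]
          tail_coboundary_pushforward[of n f xs]
        by (simp add: pushforward_def[of "Suc n"] pushforward_def[of n f us] \<rho>_diff \<rho>_mult \<rho>_inv_\<rho>)
    qed (simp add: hochschild_b_outside pushforward_def \<rho>_0)
  qed
qed (simp add: pushforward_def \<rho>_add fun_eq_iff)

lemma pushforward_homotopic_id:
  assumes f: "f \<in> cocycles UNIV n"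
  shows "f - (pushforward n ^^ r) f \<in> coboundaries UNIV n"
    and "(pushforward n ^^ r) f \<in> cocycles UNIV n"
proof (induction r)
  case 0
  show "f - (pushforward n ^^ 0) f \<in> coboundaries UNIV n" using coboundaries_0[OF subspace_UNIV] by simp
  show "(pushforward n ^^ 0) f \<in> cocycles UNIV n" using f by simp
next
  case (Suc r)
  let ?g = "(pushforward n ^^ r) f"
  show Z: "(pushforward n ^^ Suc r) f \<in> cocycles UNIV n"
    using cochain_map_cocycles[OF cochain_map_pushforward Suc(2)] by simp
  have "pullback (pushforward n ?g) = ?g"
    by (simp add: fun_eq_iff pullback_def pushforward_def inv_\<rho>_\<rho> comp_def)
  then have "pushforward n ?g - ?g \<in> coboundaries UNIV n"
    using pullback_homotopic_id[OF Z] by simp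
  from coboundaries_diff[OF subspace_UNIV Suc(1) this]
  have "(f - ?g) - (pushforward n ?g - ?g) \<in> coboundaries UNIV n" .
  moreover have "(f - ?g) - (pushforward n ?g - ?g) = f - (pushforward n ^^ Suc r) f"
    by (simp add: fun_eq_iff)
  ultimately show "f - (pushforward n ^^ Suc r) f \<in> coboundaries UNIV n" by simp
qed

definition average :: "nat \<Rightarrow> ('a list \<Rightarrow> 'a) \<Rightarrow> ('a list \<Rightarrow> 'a)" where
  "average n f = smul (inverse (of_nat m)) (\<Sum>r<m. (pushforward n ^^ r) f)"

lemma average_cocycle:
  assumes "f \<in> cocycles UNIV n"
  shows "average n f \<in> cocycles UNIV n" "f - average n f \<in> coboundaries UNIV n"
proof -
  show "average n f \<in> cocycles UNIV n"
    unfolding average_def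
    by (intro cocycles_smul cocycles_sum pushforward_homotopic_id(2) assms subspace_UNIV)
  have "f - average n f = smul (inverse (of_nat m)) (\<Sum>r<m. f - (pushforward n ^^ r) f)"
    using m_nonzero
    by (simp add: average_def fun_eq_iff sum_fun_apply sum_subtractf scale_right_diff_distrib sum_constant_scale)
  also have "\<dots> \<in> coboundaries UNIV n"
    by (intro coboundaries_smul coboundaries_sum pushforward_homotopic_id(1) assms subspace_UNIV)
  finally show "f - average n f \<in> coboundaries UNIV n" .
qed

text \<open>This is the reason for averaging: on degree-zero arguments the average already takes the values of
  the restriction.\<close>

lemma average_on_B: "average n f xs = proj (f xs)" if xs: "xs \<in> tuples B n"
proof -
  have "inv \<rho> x = x" if "x \<in> set xs" for x
  proof -
    have "x \<in> B" using xs that by (auto simp: tuples_def)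
    then show ?thesis using inv_\<rho>_\<rho>[of x] by (simp only: B_iff)
  qed
  then have "map (inv \<rho>) xs = xs" by (rule map_idI)
  then have "(pushforward n ^^ r) f xs = (\<rho> ^^ r) (f xs)" for r
    by (induction r) (simp_all add: pushforward_def)
  then show ?thesis by (simp add: average_def proj_def sum_fun_apply)
qed

text \<open>The transfer of the restriction depends on values on degree-zero arguments alone, so it is also the
  transfer of the average; there the homotopy to the multiplication by \<open>m\<close> applies, as the
  average is a cochain of the whole algebra.\<close>

lemma coboundary_if_restrict_coboundary:
  assumes f: "f \<in> cocycles UNIV n" and r: "restrict n f \<in> coboundaries B n"
  shows "f \<in> coboundaries UNIV n"
proof -
  let ?g = "average n f"
  have "extend n (restrict n f) = extend n ?g"
    by (rule transfer_cong[of K UNIV E B])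
      (auto simp: E_def proj_in_B restrict_def average_on_B)
  then have 1: "extend n ?g \<in> coboundaries UNIV n"
    using cochain_map_coboundaries[OF cochain_map_extend r] by simp
  have "(\<Sum>\<kappa>\<in>K. sK' \<kappa> * sK \<kappa>) = scale (of_nat m) 1"
    by (simp add: sum_K sum_s's sum_constant_scale)
  from matrix_map.transfer_homotopic_multiple[OF matrix_map_UNIV refl refl this average_cocycle(1)[OF f]]
  have "smul (of_nat m) ?g - extend n ?g \<in> coboundaries UNIV n" .
  from coboundaries_add[OF subspace_UNIV this 1]
  have "smul (of_nat m) ?g \<in> coboundaries UNIV n" by simp
  from coboundaries_smul[OF subspace_UNIV this, of "inverse (of_nat m)"]
  have "?g \<in> coboundaries UNIV n" using m_nonzero by simp
  from coboundaries_add[OF subspace_UNIV average_cocycle(2)[OF f] this] show ?thesis by simp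
qed

text \<open>The preimage of an invariant class is \<open>1/m\<close> times its transfer, since restricting the transfer sums
  over the group.\<close>

lemma ex_cocycle_restrict:
  assumes f: "f \<in> cocycles B n"
    and inv: "\<And>i. i < m \<Longrightarrow> theta i n f - f \<in> coboundaries B n"
  shows "\<exists>g\<in>cocycles UNIV n. restrict n g - f \<in> coboundaries B n"
proof
  let ?g = "smul (inverse (of_nat m)) (extend n f)"
  show "?g \<in> cocycles UNIV n"
    by (intro cocycles_smul cochain_map_cocycles[OF cochain_map_extend] f subspace_UNIV)
  have "restrict n ?g - f = smul (inverse (of_nat m)) (\<Sum>i<m. theta i n f - f)"
    using m_nonzero f
    by (simp add: restrict_smul restrict_extend hochschild_cocycles_def fun_eq_iff sum_fun_apply
        sum_subtractf scale_right_diff_distrib sum_constant_scale)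
  also have "\<dots> \<in> coboundaries B n"
    by (intro coboundaries_smul coboundaries_sum inv subspace_B) simp
  finally show "restrict n ?g - f \<in> coboundaries B n" .
qed

section \<open>The isomorphism\<close>

theorem HH_iso_invariants:
  fixes n :: nat and \<Phi> :: "('a list \<Rightarrow> 'a) set \<Rightarrow> ('a list \<Rightarrow> 'a) set"
  defines "\<Phi> \<equiv> HH_induced scale B n (restrict n)"
  shows "bij_betw \<Phi> (HH scale UNIV n) (HH_invariants scale B m J s s' n)"
    and "\<And>X Y. X \<in> HH scale UNIV n \<Longrightarrow> Y \<in> HH scale UNIV n \<Longrightarrow> \<Phi> (X + Y) = \<Phi> X + \<Phi> Y"
    and "\<And>c X. X \<in> HH scale UNIV n \<Longrightarrow> \<Phi> (HH_scale scale UNIV n c X) = HH_scale scale B n c (\<Phi> X)"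
proof -
  have \<Phi>: "\<Phi> (f +o coboundaries UNIV n) = restrict n f +o coboundaries B n" for f
    unfolding \<Phi>_def by (rule HH_induced_coset[OF cochain_map_restrict subspace_UNIV subspace_B])
  have \<theta>: "HH_induced scale B n (theta i n) (f +o coboundaries B n) = theta i n f +o coboundaries B n"
    if "i < m" for i f
    by (rule HH_induced_coset[OF cochain_map_theta[OF that] subspace_B subspace_B])
  have inv_iff: "f +o coboundaries B n \<in> HH_invariants scale B m J s s' n \<longleftrightarrow>
      (\<forall>i<m. theta i n f - f \<in> coboundaries B n)" if "f \<in> cocycles B n" for f
    using imageI[OF that, of "\<lambda>f. f +o coboundaries B n"]
    unfolding HH_invariants_def by (simp add: HH_def \<theta> coset_eq_iff[OF subspace_B])
  show "bij_betw \<Phi> (HH scale UNIV n) (HH_invariants scale B m J s s' n)"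
    unfolding bij_betw_def
  proof
    show "inj_on \<Phi> (HH scale UNIV n)"
    proof (rule inj_onI)
      fix X Y assume "X \<in> HH scale UNIV n" "Y \<in> HH scale UNIV n" and eq: "\<Phi> X = \<Phi> Y"
      then obtain f g where f: "f \<in> cocycles UNIV n" "X = f +o coboundaries UNIV n"
        and g: "g \<in> cocycles UNIV n" "Y = g +o coboundaries UNIV n"
        by (auto simp: HH_def)
      have "restrict n (f - g) \<in> coboundaries B n"
        using eq unfolding f(2) g(2) \<Phi> coset_eq_iff[OF subspace_B] cochain_map_diff[OF cochain_map_restrict] .
      then have "f - g \<in> coboundaries UNIV n"
        by (intro coboundary_if_restrict_coboundary cocycles_diff subspace_UNIV f g)
      then show "X = Y" unfolding f(2) g(2) coset_eq_iff[OF subspace_UNIV] .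
    qed
    show "\<Phi> ` HH scale UNIV n = HH_invariants scale B m J s s' n"
    proof (intro equalityI subsetI)
      fix X assume "X \<in> \<Phi> ` HH scale UNIV n"
      then obtain f where f: "f \<in> cocycles UNIV n" "X = restrict n f +o coboundaries B n"
        by (auto simp: HH_def \<Phi>)
      then show "X \<in> HH_invariants scale B m J s s' n"
        using inv_iff[OF cochain_map_cocycles[OF cochain_map_restrict f(1)]] restrict_theta[OF _ f(1)] by simp
    next
      fix X assume X: "X \<in> HH_invariants scale B m J s s' n"
      then obtain f where f: "f \<in> cocycles B n" "X = f +o coboundaries B n"
        by (auto simp: HH_invariants_def HH_def)
      then obtain g where g: "g \<in> cocycles UNIV n" "restrict n g - f \<in> coboundaries B n"
        using ex_cocycle_restrict inv_iff X by blast
      then have "\<Phi> (g +o coboundaries UNIV n) = X"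
        unfolding f(2) \<Phi> coset_eq_iff[OF subspace_B] by blast
      moreover have "g +o coboundaries UNIV n \<in> HH scale UNIV n"
        unfolding HH_def using g(1) by (rule imageI)
      ultimately show "X \<in> \<Phi> ` HH scale UNIV n" by blast
    qed
  qed
  have restrict_add: "restrict n (f + g) = restrict n f + restrict n g" for f g
    using cochain_map_restrict unfolding cochain_map_def by blast
  show "\<Phi> (X + Y) = \<Phi> X + \<Phi> Y" if XY: "X \<in> HH scale UNIV n" "Y \<in> HH scale UNIV n" for X Y
  proof -
    obtain f g where "X = f +o coboundaries UNIV n" "Y = g +o coboundaries UNIV n"
      using XY unfolding HH_def by blast
    then show ?thesis
      by (simp only: \<Phi> coset_add[OF subspace_UNIV] coset_add[OF subspace_B] restrict_add)
  qed
  show "\<Phi> (HH_scale scale UNIV n c X) = HH_scale scale B n c (\<Phi> X)"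
    if X: "X \<in> HH scale UNIV n" for c X
  proof -
    obtain f where "X = f +o coboundaries UNIV n" using X unfolding HH_def by blast
    then show ?thesis
      by (simp only: \<Phi> HH_scale_coset[OF subspace_UNIV] HH_scale_coset[OF subspace_B] restrict_smul)
  qed
qed

end

theorem theoremB:
  fixes scale :: "'k::field \<Rightarrow> 'a::{ring, monoid_mult} \<Rightarrow> 'a"
    and Basis :: "'a set"
    and \<phi> :: "'a \<Rightarrow> 'k" and \<rho> :: "'a \<Rightarrow> 'a" and m :: nat and w :: 'k
    and A :: "nat \<Rightarrow> 'a set"
    and J :: "nat \<Rightarrow> 'j set" and s s' :: "nat \<Rightarrow> 'j \<Rightarrow> 'a"
    and n :: nat
  assumes "algebra_over_field scale"
    and "finite_dimensional_vector_space scale Basis"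
    and "frobenius_hom scale \<phi>"
    and "nakayama_automorphism scale \<phi> \<rho>"
    and "has_order \<rho> m"
    and "primitive_root_of_unity m w"
    and A_def: "A = eigencomponent scale \<rho> w"
    and "strongly_graded scale m A"
    and "action_families m A J s s'"
  shows "\<exists>\<Phi>. bij_betw \<Phi> (HH scale UNIV n) (HH_invariants scale (A 0) m J s s' n) \<and>
           (\<forall>X\<in>HH scale UNIV n. \<forall>Y\<in>HH scale UNIV n. \<Phi> (X + Y) = \<Phi> X + \<Phi> Y) \<and>
           (\<forall>c. \<forall>X\<in>HH scale UNIV n.
              \<Phi> (HH_scale scale UNIV n c X) = HH_scale scale (A 0) n c (\<Phi> X))"
proof -
  interpret algebra_over_field scale by fact
  interpret nakayama_graded scale \<phi> \<rho> m w J s s'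
    using assms by unfold_locales simp_all
  show ?thesis
    unfolding A_def using HH_iso_invariants by blast
qed

end
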